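(* The following three identities hold: $$\sum_{k=1}^\infty \frac{4^k}{(2k-1)k^3\binom{2k}{k}^2} \left( (3k-1)(2H_{2k-1}-3H_{k-1}) + \frac{2k}{2k-1}\right) = \frac{\pi^4}{16},$$ $$\sum_{k=1}^\infty \frac{(3k-1)4^k}{(2k-1)k^3\binom{2k}{k}^2} \left( 4H^{(2)}_{2k-1} - 5H_{k-1}^{(2)} \right) = \frac{31}{4} \zeta(5),$$ and $$\sum_{k=1}^\infty \frac{(3k-1)4^k}{(2k-1)k^3\binom{2k}{k}^2} \left(8H^{(3)}_{2k-1} +7H_{k-1}^{(3)} \right) = \frac{49}{4} \zeta(3)^2.$$
   Context: For integers $m\ge1$ and $n\ge0$, $H_n^{(m)}=\sum_{0<j\le n}\frac1{j^m}$ denotes the harmonic number of order $m$, and $H_n=H_n^{(1)}$ (so $H_0=H_0^{(m)}=0$). $\zeta$ is the Riemann zeta function. *)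

theory Defs
  imports "HOL-Analysis.Analysis"
begin

(* gharm m n is the harmonic number H_n^(m): the order comes first. *)
definition gharm :: "nat \<Rightarrow> nat \<Rightarrow> real" where
  "gharm m n = (\<Sum>j = 1..n. 1 / real j ^ m)"

(* The Riemann zeta function on the half-line s > 1, where its Dirichlet series
   converges; for other real s the definition is not meaningful. *)
definition zeta :: "real \<Rightarrow> real" where
  "zeta s = (\<Sum>n. 1 / real (Suc n) powr s)"

end

theory Submission
  imports Defs "HOL-Real_Asymp.Real_Asymp"
begin

text \<open>
  Write \<open>m = n + 1/2\<close> and let \<open>(c)\<^sub>k\<close> denote rising factorials. Up to constant factors, all three series are
  derivatives at 0 of specializations of the quadratic hypergeometric series

    \<open>P(u, v, w) = 1 + (\<Sum>k\<ge>1. (3k - 1 + 2s) / (2s - 1) * (2u)\<^sub>k (2v)\<^sub>k (2w)\<^sub>k (s - 1/2)\<^sub>k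
                  / ((1/2 + u + v)\<^sub>k (1/2 + u + w)\<^sub>k (1/2 + v + w)\<^sub>k k! 4^k))\<close>,  \<open>s = u + v + w\<close>,

  which depends on \<open>v\<close> and \<open>w\<close> only through \<open>e = v + w\<close> and \<open>f = v w\<close>. In these parameters it is
  \<open>1 + f * series u e f\<close> and remains real when \<open>v\<close> and \<open>w\<close> are complex conjugates.

  A Wilf--Zeilberger certificate (\<open>wz_telescoping\<close>) gives \<open>P(u) = (1 - f / q(u)) P(u + 1)\<close> with
  \<open>q(u) = (u + 1/2)^2 + e (u + 1/2) + f\<close>. Since \<open>P(u)\<close> converges as \<open>u\<close> tends to infinity and
  \<open>P(0) = 1\<close>, comparing the iterates started at \<open>u\<close> with those started at \<open>0\<close> evaluates \<open>P(u)\<close>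
  without knowledge of the limit. Two consequences are needed.

  For \<open>f = 0\<close> the recurrence is additive, and \<open>series u e 0\<close> is the sum of
  \<open>1 / (m (m + e)) - 1 / ((m + u) (m + u + e))\<close> over \<open>n\<close> (\<open>series_0_sums\<close>). Division by \<open>u\<close> leads, for
  \<open>u = y, e = 0\<close>, to the sum of \<open>(2m + y) / (m^2 (m + y)^2)\<close>, whose derivative at \<open>y = 0\<close> is
  \<open>-3 * (\<Sum>n. 1 / m^4) = - pi^4 / 2\<close>; and, for \<open>u = x, e = -x, y = x^2\<close>, to the sum of
  \<open>2 / (m (m^2 - y))\<close>, whose derivative is \<open>2 * (\<Sum>n. 1 / m^5) = 62 \<zeta>(5)\<close>. These give the first two
  identities. Both families, and also \<open>H\<close> below, have the value \<open>2 * (\<Sum>n. 1 / m^3) = 14 \<zeta>(3)\<close> at \<open>y = 0\<close>.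

  For \<open>u = x, e = -x, f = x^2\<close>, where \<open>u, v, w\<close> are \<open>x\<close> times the three cube roots of unity, the
  series is \<open>1 + y H(y)\<close> with \<open>y = x^3\<close>, and the product formula shows that replacing \<open>x\<close> by \<open>-x\<close>
  inverts it (\<open>cubic_family_reflection\<close>). From \<open>(1 + y H(y)) (1 - y H(-y)) = 1\<close> one gets
  \<open>(H(y) - H(-y)) / y = H(y) H(-y)\<close>, hence \<open>2 H'(0) = H(0)^2 = (14 \<zeta>(3))^2\<close>. This is the third
  identity, and it explains why a square of \<open>\<zeta>(3)\<close> appears.

  On the other side, in each of the three families the summand is the summand at \<open>y = 0\<close>, which is
  8 times the factor \<open>(3k - 1) 4^k / ((2k - 1) k^3 (2k choose k)^2)\<close> of the theorem,
  multiplied by a finite product of factors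
  \<open>(1 + a y)\<close> and \<open>1 / (1 + b y)\<close>. Its logarithmic derivative at \<open>0\<close> is the sum of the \<open>a\<close> minus the
  sum of the \<open>b\<close>, and these are the combinations of harmonic numbers in the theorem.
  Termwise differentiation is justified by \<open>rational_prod_series_derivative\<close>.
\<close>

section \<open>A Wilf--Zeilberger pair\<close>

text \<open>
  With \<open>e = v + w\<close> and \<open>f = v w\<close> this is \<open>(1/2 + u + v + j) (1/2 + u + w + j)\<close>.
\<close>
definition quad :: "real \<Rightarrow> real \<Rightarrow> real \<Rightarrow> nat \<Rightarrow> real" where
  "quad u e f j = (1/2 + u + real j)\<^sup>2 + e * (1/2 + u + real j) + f"

text \<open>
  The quotient of consecutive certificates. The quadratic polynomial in \<open>j + 1\<close> is
  \<open>(2v + j + 1) (2w + j + 1)\<close> written in terms of \<open>e\<close> and \<open>f\<close>.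
\<close>
definition ratio :: "real \<Rightarrow> real \<Rightarrow> real \<Rightarrow> nat \<Rightarrow> real" where
  "ratio u e f j =
     (2 * u + 1 + real j) * (u + e + 1/2 + real j) / quad u e f (Suc j)
     * ((real j + 1)\<^sup>2 + 2 * e * (real j + 1) + 4 * f)
     / (4 * (1/2 + e + real j) * (real j + 1))"

text \<open>
  The companion of \<open>u * summand u e f k\<close> in the Wilf--Zeilberger pair. Its value
  \<open>1 / quad u e f 0\<close> at \<open>k = 0\<close> becomes the inhomogeneous term of the recurrence in \<open>u\<close>.
\<close>
definition wz_cert :: "real \<Rightarrow> real \<Rightarrow> real \<Rightarrow> nat \<Rightarrow> real" where
  "wz_cert u e f k = (\<Prod>j<k. ratio u e f j) / quad u e f 0"

text \<open>
  The terms of \<open>P(u, v, w)\<close> with \<open>k \<ge> 1\<close>, with \<open>k\<close> lowered by one and divided by \<open>f u\<close>. Removing these two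
  factors keeps the summand meaningful at \<open>u = 0\<close> and \<open>f = 0\<close>, where the derivatives are taken.
\<close>
definition summand :: "real \<Rightarrow> real \<Rightarrow> real \<Rightarrow> nat \<Rightarrow> real" where
  "summand u e f k =
     wz_cert u e f k * (3 * real k + 2 + 2 * u + 2 * e) / ((1/2 + e + real k) * (real k + 1))"

definition series :: "real \<Rightarrow> real \<Rightarrow> real \<Rightarrow> real" where
  "series u e f = (\<Sum>k. u * summand u e f k)"

text \<open>
  A region that is closed under \<open>u \<mapsto> u + 1\<close>, contains all parameters of interest near \<open>0\<close>, and on which
  the series are dominated by one geometric series, uniformly in \<open>u\<close>.
\<close>
definition admissible :: "real \<Rightarrow> real \<Rightarrow> real \<Rightarrow> bool" where
  "admissible u e f \<longleftrightarrow> -1/8 \<le> u \<and> \<bar>e\<bar> \<le> 1/8 \<and> 0 \<le> f \<and> f \<le> 1/16"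

lemma quad_Suc_shift: "quad (u + 1) e f j = quad u e f (Suc j)"
  by (simp add: quad_def algebra_simps)

lemma quad_lower_bound:
  assumes "admissible u e f"
  shows "(1/2 + u + real j)\<^sup>2 / 2 \<le> quad u e f j"
proof -
  define s where "s = 1/2 + u + real j"
  have s: "s \<ge> 3/8" and e: "-1/8 \<le> e" and f: "f \<ge> 0" using assms by (auto simp: s_def admissible_def)
  have "s * (s / 2 + e) \<ge> 0" using s e by (intro mult_nonneg_nonneg) auto
  thus ?thesis using f unfolding quad_def s_def[symmetric] by (simp add: power2_eq_square algebra_simps)
qed

lemma quad_pos:
  assumes "admissible u e f"
  shows "quad u e f j > 0"
proof -
  have "0 < (1/2 + u + real j)\<^sup>2 / 2"
    using assms by (auto simp: admissible_def)
  thus ?thesis using quad_lower_bound[OF assms, of j] by linarith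
qed

lemma wz_cert_0: "wz_cert u e f 0 = 1 / quad u e f 0"
  by (simp add: wz_cert_def)

lemma wz_cert_Suc: "wz_cert u e f (Suc k) = wz_cert u e f k * ratio u e f k"
  by (simp add: wz_cert_def)

lemma admissible_Suc: "admissible u e f \<Longrightarrow> admissible (u + 1) e f"
  by (auto simp: admissible_def)

text \<open>
  The certificate at \<open>u + 1\<close> is a rational multiple of the one at \<open>u\<close> because all rising
  factorials involved are shifted by an integer. The factor \<open>1 - f / quad u e f 0\<close> of the recurrence
  is what makes the two sides agree at \<open>k = 0\<close>.
\<close>
lemma wz_cert_shift:
  assumes "admissible u e f"
  shows "(1 - f / quad u e f 0) * (u + 1) * wz_cert (u + 1) e f k =
         wz_cert u e f k * (2 * u + 1 + real k) * (2 * u + 2 + real k) * (u + e + 1/2 + real k)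
           / (4 * quad u e f (Suc k))"
proof (induction k)
  case 0
  have q: "quad u e f 0 > 0" "quad u e f (Suc 0) > 0" using assms quad_pos by auto
  have "1 - f / quad u e f 0 = (1/2 + u) * (1/2 + u + e) / quad u e f 0"
    using q(1) by (simp add: field_simps) (simp add: quad_def power2_eq_square field_simps)
  thus ?case using q by (simp add: wz_cert_0 quad_Suc_shift) (simp add: field_simps)
next
  case (Suc k)
  have r: "ratio (u + 1) e f k = (2 * u + 3 + real k) * (u + e + 3/2 + real k) / quad u e f (Suc (Suc k))
     * ((real k + 1)\<^sup>2 + 2 * e * (real k + 1) + 4 * f) / (4 * (1/2 + e + real k) * (real k + 1))"
  proof -
    have "2 * (u + 1) + 1 + real k = 2 * u + 3 + real k" "u + 1 + e + 1/2 + real k = u + e + 3/2 + real k"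
      by simp_all
    thus ?thesis unfolding ratio_def quad_Suc_shift by (simp only:)
  qed
  have s: "2 * u + 1 + real (Suc k) = 2 * u + 2 + real k" "2 * u + 2 + real (Suc k) = 2 * u + 3 + real k"
    "u + e + 1/2 + real (Suc k) = u + e + 3/2 + real k"
    by simp_all
  show ?case
    unfolding wz_cert_Suc mult.assoc[symmetric] Suc.IH r s
    by (simp add: ratio_def mult_ac)
qed

text \<open>
  The shape of the rational identity behind the Wilf--Zeilberger pair, with the denominators as atoms:
  only the polynomial identity in the last hypothesis depends on the particular certificate.
\<close>
lemma wz_fraction_identity:
  fixes q :: real
  assumes "q \<noteq> 0" "m \<noteq> 0" "n \<noteq> 0" "4 * q * X - Y * Z = R * D - 4 * q * (m * n)"
  shows "X / (m * n) - Y / (4 * q) * Z / (m * n) = R / q * D / (4 * m * n) - 1"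
proof -
  have "X / (m * n) - Y / (4 * q) * Z / (m * n) = (4 * q * X - Y * Z) / (4 * q * (m * n))"
    using assms(1-3) by (simp add: divide_simps)
  also have "\<dots> = R * D / (4 * q * (m * n)) - 1"
    unfolding assms(4) using assms(1-3) by (simp add: diff_divide_distrib)
  finally show ?thesis by (simp add: mult_ac)
qed

text \<open>
  After division by the certificate at \<open>u\<close> and \<open>k\<close> this is an identity between rational functions of
  \<open>u, e, f\<close> and \<open>k\<close>.
\<close>
lemma wz_telescoping:
  assumes "admissible u e f"
  shows "u * summand u e f k - (1 - f / quad u e f 0) * ((u + 1) * summand (u + 1) e f k)
         = wz_cert u e f (Suc k) - wz_cert u e f k"
proof -
  define q where "q = quad u e f (Suc k)"
  define m where "m = 1/2 + e + real k"
  define n where "n = real k + 1"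
  define X where "X = u * (3 * real k + 2 + 2 * u + 2 * e)"
  define Y where "Y = (2 * u + 1 + real k) * (2 * u + 2 + real k) * (u + e + 1/2 + real k)"
  define Z where "Z = 3 * real k + 4 + 2 * u + 2 * e"
  have q: "q \<noteq> 0" using assms quad_pos[of u e f "Suc k"] by (auto simp: q_def)
  have mn: "m \<noteq> 0" "n \<noteq> 0" using assms by (auto simp: admissible_def m_def n_def)
  have c: "(1 - f / quad u e f 0) * (u + 1) * wz_cert (u + 1) e f k = wz_cert u e f k * Y / (4 * q)"
    unfolding wz_cert_shift[OF assms] Y_def q_def by (simp add: mult_ac)
  have "(1 - f / quad u e f 0) * ((u + 1) * summand (u + 1) e f k) =
    (1 - f / quad u e f 0) * (u + 1) * wz_cert (u + 1) e f k * Z / (m * n)"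
    by (simp add: summand_def Z_def m_def n_def mult_ac add_ac)
  also have "\<dots> = wz_cert u e f k * (Y / (4 * q) * Z / (m * n))"
    unfolding c by simp
  finally have 1: "(1 - f / quad u e f 0) * ((u + 1) * summand (u + 1) e f k) =
     wz_cert u e f k * (Y / (4 * q) * Z / (m * n))" .
  have 2: "u * summand u e f k = wz_cert u e f k * (X / (m * n))"
    by (simp add: summand_def X_def m_def n_def mult_ac)
  have 3: "X / (m * n) - Y / (4 * q) * Z / (m * n) = ratio u e f k - 1"
    unfolding ratio_def q_def[symmetric] m_def[symmetric] n_def[symmetric]
  proof (rule wz_fraction_identity[OF q mn])
    show "4 * q * X - Y * Z = (2 * u + 1 + real k) * (u + e + 1 / 2 + real k) *
        (n\<^sup>2 + 2 * e * n + 4 * f) - 4 * q * (m * n)"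
      unfolding X_def Y_def Z_def m_def n_def q_def quad_def power2_eq_square of_nat_Suc
      by (simp add: field_simps)
  qed
  show ?thesis
    unfolding 1 2 wz_cert_Suc right_diff_distrib[symmetric] 3 by (simp add: right_diff_distrib)
qed


section \<open>Convergence and the recurrence in u\<close>

text \<open>
  For large \<open>j\<close> the ratio is close to 1/4 as long as \<open>u\<close> is bounded, and close to 1/2 when \<open>u\<close> is much
  larger still. Pairing each numerator factor with a denominator factor proves this; the constant 3/4 leaves
  room for the perturbation by \<open>e\<close> and \<open>f\<close>. At \<open>j = 0\<close> only a weaker bound holds, because there
  \<open>(j + 1) / (j + 1/2)\<close> equals 2.
\<close>
lemma ratio_bounds:
  assumes "admissible u e f"
  shows "0 \<le> ratio u e f j" "ratio u e f j \<le> (if j = 0 then 3/2 else 3/4)"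
proof -
  define s where "s = 1/2 + u + real (Suc j)"
  define q where "q = quad u e f (Suc j)"
  define D where "D = (real j + 1)\<^sup>2 + 2 * e * (real j + 1) + 4 * f"
  define E where "E = (1/2 + e + real j) * (real j + 1)"
  have a: "-1/8 \<le> u" "-1/8 \<le> e" "e \<le> 1/8" "0 \<le> f" "f \<le> 1/16"
    using assms by (auto simp: admissible_def)
  have q: "q > 0" unfolding q_def by (rule quad_pos[OF assms])
  have E: "E > 0" unfolding E_def using a by (intro mult_pos_pos) auto
  have D: "D \<ge> 0"
  proof -
    have "0 \<le> (real j + 1) * (real j + 1 + 2 * e)" using a by (intro mult_nonneg_nonneg) auto
    thus ?thesis using a by (simp add: D_def power2_eq_square algebra_simps)
  qed
  have N: "0 \<le> (2 * u + 1 + real j) * (u + e + 1/2 + real j)"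
    using a by (intro mult_nonneg_nonneg) auto
  have Nq: "(2 * u + 1 + real j) * (u + e + 1/2 + real j) \<le> 2 * q"
  proof -
    have "(2 * u + 1 + real j) * (u + e + 1/2 + real j) \<le> (2 * s) * (s + e)"
      using a by (intro mult_mono) (auto simp: s_def)
    also have "\<dots> \<le> 2 * q" using a unfolding q_def quad_def s_def[symmetric]
      by (simp add: power2_eq_square algebra_simps)
    finally show ?thesis .
  qed
  have DE: "D \<le> (if j = 0 then 3 else 3/2) * E"
  proof (cases j)
    case 0
    thus ?thesis using a by (simp add: D_def E_def)
  next
    case (Suc i)
    have "2 * f * 2 \<le> 2 * f * (real j + 1)" using Suc a by (intro mult_left_mono) auto
    hence "D \<le> (real j + 1) * ((real j + 1) + 2 * e + 2 * f)"
      by (simp add: D_def power2_eq_square algebra_simps)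
    also have "(real j + 1) + 2 * e + 2 * f \<le> 3/2 * (1/2 + e + real j)" using Suc a by simp
    hence "(real j + 1) * ((real j + 1) + 2 * e + 2 * f) \<le> (real j + 1) * (3/2 * (1/2 + e + real j))"
      by (intro mult_left_mono) auto
    also have "\<dots> = 3/2 * E" by (simp add: E_def)
    finally show ?thesis using Suc by simp
  qed
  have r: "ratio u e f j = ((2 * u + 1 + real j) * (u + e + 1/2 + real j) / q) * (D / E) / 4"
  proof -
    have "4 * (1/2 + e + real j) * (real j + 1) = E * 4" by (simp add: E_def)
    thus ?thesis unfolding ratio_def q_def[symmetric] D_def[symmetric] by simp
  qed
  show "0 \<le> ratio u e f j" unfolding r using N q D E by simp
  define W where "W = ((2 * u + 1 + real j) * (u + e + 1/2 + real j) / q) * (D / E)"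
  have "W \<le> 2 * (if j = 0 then 3 else 3/2)"
    unfolding W_def using Nq DE N D q E by (intro mult_mono) (auto simp: divide_le_eq)
  thus "ratio u e f j \<le> (if j = 0 then 3/2 else 3/4)" unfolding r W_def[symmetric] by (auto split: if_splits)
qed

lemma wz_cert_bounds:
  assumes "admissible u e f"
  shows "0 \<le> wz_cert u e f k" "wz_cert u e f k \<le> 2 * (3/4) ^ k / quad u e f 0"
proof -
  have q: "quad u e f 0 > 0" using quad_pos[OF assms] .
  show "0 \<le> wz_cert u e f k"
    unfolding wz_cert_def using q ratio_bounds(1)[OF assms] by (intro divide_nonneg_pos prod_nonneg) auto
  have "(\<Prod>j<k. ratio u e f j) \<le> 2 * (3/4) ^ k"
  proof (induction k)
    case (Suc k)
    show ?case
    proof (cases "k = 0")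
      case True
      thus ?thesis using ratio_bounds(2)[OF assms, of 0] by simp
    next
      case False
      have "(\<Prod>j<k. ratio u e f j) * ratio u e f k \<le> (2 * (3/4) ^ k) * (3/4)"
        using Suc.IH ratio_bounds[OF assms, of k] False by (intro mult_mono) auto
      thus ?thesis by simp
    qed
  qed auto
  thus "wz_cert u e f k \<le> 2 * (3/4) ^ k / quad u e f 0"
    unfolding wz_cert_def using q by (intro divide_right_mono) auto
qed

text \<open>
  The bound has to be independent of \<open>u\<close>, since it dominates the series as \<open>u\<close> tends to infinity. The
  numerator grows like \<open>u^2\<close>, and this is compensated by the first denominator \<open>quad u e f 0\<close>.
\<close>
lemma abs_summand_le:
  assumes "admissible u e f"
  shows "\<bar>u * summand u e f k\<bar> \<le> 86 * (3/4) ^ k"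
proof -
  define s where "s = 1/2 + u"
  define L where "L = 3 * real k + 2 + 2 * u + 2 * e"
  define E where "E = (1/2 + e + real k) * (real k + 1)"
  have a: "-1/8 \<le> u" "-1/8 \<le> e" "e \<le> 1/8" "0 \<le> f" "f \<le> 1/16"
    using assms by (auto simp: admissible_def)
  have s: "s \<ge> 3/8" "\<bar>u\<bar> \<le> s" using a by (auto simp: s_def)
  have L0: "L \<ge> 0" using a by (auto simp: L_def)
  have q: "quad u e f 0 > 0" "s\<^sup>2 / 2 \<le> quad u e f 0"
    using quad_pos[OF assms] quad_lower_bound[OF assms, of 0] by (auto simp: s_def)
  have E: "3/8 * (real k + 1) \<le> E" unfolding E_def using a by (intro mult_right_mono) auto
  hence E0: "E > 0" by (auto simp: algebra_simps intro: less_le_trans[rotated])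
  have "3 * real k \<le> 8 * s * real k" using s by (intro mult_right_mono) auto
  hence "L \<le> 8 * s * (real k + 1)" using s a by (simp add: L_def s_def algebra_simps)
  hence "\<bar>u\<bar> * L \<le> s * (8 * s * (real k + 1))" using s L0 by (intro mult_mono) auto
  also have "\<dots> = (16 * (s\<^sup>2 / 2)) * (real k + 1)" by (simp add: power2_eq_square)
  also have "\<dots> \<le> (16 * quad u e f 0) * (8/3 * E)"
    using q E by (intro mult_mono) auto
  finally have *: "\<bar>u\<bar> * L / (quad u e f 0 * E) \<le> 128/3"
    using q E0 by (simp add: divide_simps mult_ac)
  have "\<bar>u * summand u e f k\<bar> = wz_cert u e f k * (\<bar>u\<bar> * L / E)"
    using wz_cert_bounds(1)[OF assms] L0 E0
    by (simp add: summand_def abs_mult L_def[symmetric] E_def[symmetric])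
  also have "\<dots> \<le> (2 * (3/4) ^ k / quad u e f 0) * (\<bar>u\<bar> * L / E)"
    using wz_cert_bounds(2)[OF assms] L0 E0 by (intro mult_right_mono) auto
  also have "\<dots> = 2 * (3/4) ^ k * (\<bar>u\<bar> * L / (quad u e f 0 * E))" by simp
  also have "\<dots> \<le> 2 * (3/4) ^ k * (128/3)" using * by (intro mult_left_mono) auto
  also have "\<dots> \<le> 86 * (3/4) ^ k" by simp
  finally show ?thesis .
qed

lemma summable_geometric_3_4: "summable (\<lambda>k. c * (3/4 :: real) ^ k)"
  by (intro summable_mult summable_geometric) auto

lemma wz_cert_tendsto_0:
  assumes "admissible u e f"
  shows "wz_cert u e f \<longlonglongrightarrow> 0"
proof (rule tendsto_sandwich[OF _ _ tendsto_const])
  show "(\<lambda>k. 2 / quad u e f 0 * (3/4) ^ k) \<longlonglongrightarrow> 0"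
    by (rule summable_LIMSEQ_zero[OF summable_geometric_3_4])
qed (use wz_cert_bounds[OF assms] in auto)

lemma summable_scaled_summand:
  assumes "admissible u e f"
  shows "summable (\<lambda>k. u * summand u e f k)"
  by (rule summable_comparison_test'[OF summable_geometric_3_4[of 86]])
     (use abs_summand_le[OF assms] in auto)

text \<open>
  Summing the Wilf--Zeilberger identity over \<open>k\<close>, only the boundary term at \<open>k = 0\<close> survives.
\<close>
lemma series_rec:
  assumes "admissible u e f"
  shows "series u e f = (1 - f / quad u e f 0) * series (u + 1) e f - 1 / quad u e f 0"
proof -
  have "(\<lambda>k. wz_cert u e f (Suc k) - wz_cert u e f k) sums (0 - wz_cert u e f 0)"
    by (rule telescope_sums[OF wz_cert_tendsto_0[OF assms]])
  moreover have "(\<lambda>k. u * summand u e f k - (1 - f / quad u e f 0) * ((u + 1) * summand (u + 1) e f k))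
      sums (series u e f - (1 - f / quad u e f 0) * series (u + 1) e f)"
    unfolding series_def
    by (intro sums_diff sums_mult summable_sums summable_scaled_summand assms admissible_Suc)
  ultimately have "0 - wz_cert u e f 0 = series u e f - (1 - f / quad u e f 0) * series (u + 1) e f"
    unfolding wz_telescoping[OF assms] by (rule sums_unique2)
  thus ?thesis by (simp add: wz_cert_0)
qed

lemma ratio_convergent_at_top: "\<exists>l. ((\<lambda>u. ratio u e f j) \<longlongrightarrow> l) at_top"
proof -
  have "((\<lambda>u. (2 * u + 1 + real j) * (u + e + 1/2 + real j) / quad u e f (Suc j)) \<longlongrightarrow> 2) at_top"
    unfolding quad_def by real_asymp
  from tendsto_mult_right[OF this, of "((real j + 1)\<^sup>2 + 2 * e * (real j + 1) + 4 * f)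
     / (4 * (1/2 + e + real j) * (real j + 1))"]
  show ?thesis unfolding ratio_def by (intro exI) (simp add: mult_ac)
qed

lemma summand_convergent_at_top: "\<exists>l. ((\<lambda>u. u * summand u e f k) \<longlongrightarrow> l) at_top"
proof -
  obtain l where l: "\<And>j. ((\<lambda>u. ratio u e f j) \<longlongrightarrow> l j) at_top"
    using ratio_convergent_at_top[of e f] by metis
  have "((\<lambda>u. u * (3 * real k + 2 + 2 * u + 2 * e) / quad u e f 0) \<longlongrightarrow> 2) at_top"
    unfolding quad_def by real_asymp
  hence "((\<lambda>u. (\<Prod>j<k. ratio u e f j) * (u * (3 * real k + 2 + 2 * u + 2 * e) / quad u e f 0)
      * (1 / ((1/2 + e + real k) * (real k + 1)))) \<longlongrightarrow>
      (\<Prod>j<k. l j) * 2 * (1 / ((1/2 + e + real k) * (real k + 1)))) at_top"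
    by (intro tendsto_mult tendsto_prod l tendsto_const)
  thus ?thesis by (intro exI) (simp add: summand_def wz_cert_def mult_ac)
qed

text \<open>
  The value of the limit, a Gauss \<open>2F1\<close> at 1/2, never enters: it cancels whenever
  two sequences of iterates with the same \<open>e\<close> and \<open>f\<close> are compared.
\<close>
lemma series_convergent_at_top:
  assumes "\<bar>e\<bar> \<le> 1/8" "0 \<le> f" "f \<le> 1/16"
  obtains L where "((\<lambda>u. series u e f) \<longlongrightarrow> L) at_top"
proof -
  obtain l where l: "\<And>k. ((\<lambda>u. u * summand u e f k) \<longlongrightarrow> l k) at_top"
    using summand_convergent_at_top[of e f] by metis
  have "eventually (\<lambda>(k, u). norm (u * summand u e f k) \<le> 86 * (3/4) ^ k) (at_top \<times>\<^sub>F at_top)"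
    unfolding eventually_prod_filter
    using assms by (intro exI[of _ "\<lambda>_. True"] exI[of _ "\<lambda>u. u \<ge> 0"] conjI eventually_ge_at_top)
      (auto intro!: abs_summand_le simp: admissible_def)
  from tannerys_theorem[OF l this summable_geometric_3_4 trivial_limit_at_top_linorder]
  show ?thesis using that unfolding series_def by blast
qed

lemma series_at_0: "series 0 e f = 0"
  by (simp add: series_def)

lemma filterlim_add_real_at_top: "filterlim (\<lambda>n. u + real n) at_top sequentially"
  by real_asymp

section \<open>Evaluation of the series\<close>

lemma series_0_iterate:
  assumes "admissible u e 0"
  shows "series u e 0 = series (u + real N) e 0 - (\<Sum>n<N. 1 / quad u e 0 n)"
proof (induction N)
  case (Suc N)
  have "admissible (u + real N) e 0" using assms by (auto simp: admissible_def)
  from series_rec[OF this]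
  have "series (u + real N) e 0 = series (u + real (Suc N)) e 0 - 1 / quad u e 0 N"
    by (simp add: quad_def algebra_simps)
  thus ?case using Suc by simp
qed auto

text \<open>
  Iterating the recurrence from \<open>u\<close> and from \<open>0\<close> leads to the same limit, and the series vanishes at
  \<open>u = 0\<close>.
\<close>
lemma series_0_sums:
  assumes "admissible u e 0"
  shows "(\<lambda>n. 1 / quad 0 e 0 n - 1 / quad u e 0 n) sums series u e 0"
proof -
  obtain L where L: "((\<lambda>u. series u e 0) \<longlongrightarrow> L) at_top"
    using series_convergent_at_top[of e 0] assms by (auto simp: admissible_def)
  have lim: "(\<lambda>n. series (v + real n) e 0) \<longlonglongrightarrow> L" for v
    by (rule filterlim_compose[OF L filterlim_add_real_at_top])
  have a0: "admissible 0 e 0" using assms by (auto simp: admissible_def)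
  have "(\<Sum>n<N. 1 / quad 0 e 0 n - 1 / quad u e 0 n) =
      series u e 0 - (series (u + real N) e 0 - series (0 + real N) e 0)" for N
    using series_0_iterate[OF assms, of N] series_0_iterate[OF a0, of N]
    by (simp add: sum_subtractf series_at_0)
  moreover have "(\<lambda>N. series u e 0 - (series (u + real N) e 0 - series (0 + real N) e 0)) \<longlonglongrightarrow>
      series u e 0 - (L - L)"
    by (intro tendsto_intros lim)
  ultimately show ?thesis by (simp add: sums_def)
qed

text \<open>
  For general \<open>f\<close> the recurrence becomes homogeneous for \<open>1 + f * series u e f\<close>, so its iteration
  produces a product instead of a sum.
\<close>
lemma series_iterate:
  assumes "admissible u e f"
  shows "1 + f * series u e f = (\<Prod>n<N. 1 - f / quad u e f n) * (1 + f * series (u + real N) e f)"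
proof (induction N)
  case (Suc N)
  have a: "admissible (u + real N) e f" using assms by (auto simp: admissible_def)
  have q: "quad (u + real N) e f 0 = quad u e f N" by (simp add: quad_def algebra_simps)
  have "1 + f * series (u + real N) e f =
    (1 - f / quad u e f N) * (1 + f * series (u + real (Suc N)) e f)"
  proof -
    have "series (u + real N) e f =
        (1 - f / quad u e f N) * series (u + real (Suc N)) e f - 1 / quad u e f N"
      using series_rec[OF a] unfolding q by (simp add: add_ac)
    thus ?thesis by (simp only:) (simp add: algebra_simps)
  qed
  thus ?case using Suc by simp
qed auto

text \<open>
  The case \<open>u = x, v = \<omega> x, w = \<omega>^2 x\<close> with a primitive cube root of unity \<open>\<omega>\<close>.
\<close>
definition cubic_family :: "real \<Rightarrow> real" where
  "cubic_family x = 1 + x\<^sup>2 * series x (- x) (x\<^sup>2)"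

lemma admissible_cubic_family: "\<bar>x\<bar> \<le> 1/8 \<Longrightarrow> admissible x (-x) (x\<^sup>2)" "\<bar>x\<bar> \<le> 1/8 \<Longrightarrow> admissible 0 (-x) (x\<^sup>2)"
  using abs_le_square_iff[of x "1/8"] by (auto simp: admissible_def power2_eq_square)

text \<open>
  The products obtained by iterating from \<open>x\<close> with \<open>e = -x\<close> and from \<open>0\<close> with \<open>e = x\<close> have the same
  factors, because \<open>quad x (-x) (x^2) = quad 0 x (x^2)\<close>. Hence all finite products cancel in
  \<open>P(x) P(-x)\<close>, and so do the limits of the tails, once these are known to be nonzero.
\<close>
lemma cubic_family_reflection:
  assumes "\<bar>x\<bar> \<le> 1/8"
  shows "cubic_family x * cubic_family (- x) = 1"
proof -
  define G where "G v y = 1 + y\<^sup>2 * series v (- y) (y\<^sup>2)" for v y :: real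
  define R where "R v y N = (\<Prod>n<N. 1 - y\<^sup>2 / quad v (- y) (y\<^sup>2) n)" for v y N
  have lim: "\<exists>L. ((\<lambda>v. G v y) \<longlongrightarrow> L) at_top" if y: "\<bar>y\<bar> \<le> 1/8" for y
  proof -
    obtain L where "((\<lambda>v. series v (- y) (y\<^sup>2)) \<longlongrightarrow> L) at_top"
      using series_convergent_at_top[of "-y" "y\<^sup>2"] admissible_cubic_family[OF y] by (auto simp: admissible_def)
    from tendsto_add[OF tendsto_const tendsto_mult[OF tendsto_const this]]
    show ?thesis unfolding G_def by blast
  qed
  have G0: "R 0 y N * G (real N) y = 1" and Gx: "G y y = R y y N * G (y + real N) y"
    if "\<bar>y\<bar> \<le> 1/8" for y N
    using series_iterate[OF admissible_cubic_family(1)[OF that], of N]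
      series_iterate[OF admissible_cubic_family(2)[OF that], of N]
    by (simp_all add: G_def R_def series_at_0)
  obtain L where L: "((\<lambda>v. G v x) \<longlongrightarrow> L) at_top" using lim assms by blast
  obtain L' where L': "((\<lambda>v. G v (-x)) \<longlongrightarrow> L') at_top" using lim[of "-x"] assms by auto
  note seq = filterlim_compose[OF _ filterlim_add_real_at_top]
  have R01: "0 \<le> R 0 y N" "R 0 y N \<le> 1" if "\<bar>y\<bar> \<le> 1/8" for y N
  proof -
    have "0 \<le> 1 - y\<^sup>2 / quad 0 (- y) (y\<^sup>2) n \<and> 1 - y\<^sup>2 / quad 0 (- y) (y\<^sup>2) n \<le> 1" for n
    proof -
      have q: "quad 0 (- y) (y\<^sup>2) n > 0" by (rule quad_pos[OF admissible_cubic_family(2)[OF that]])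
      have "0 \<le> (1/2 + real n) * (1/2 + real n - y)" using that by (intro mult_nonneg_nonneg) auto
      hence "y\<^sup>2 \<le> quad 0 (- y) (y\<^sup>2) n" by (simp add: quad_def power2_eq_square algebra_simps)
      thus ?thesis using q by (auto simp: divide_le_eq)
    qed
    thus "0 \<le> R 0 y N" "R 0 y N \<le> 1" unfolding R_def by (auto intro!: prod_nonneg prod_le_1)
  qed
  \<comment> \<open>A product of factors in [0, 1] times the tail is 1, so the tail is at least 1 and its limit is not 0.\<close>
  have G1: "G (real N) y \<ge> 1" if "\<bar>y\<bar> \<le> 1/8" for y N
  proof (rule ccontr)
    assume *: "\<not> G (real N) y \<ge> 1"
    have "R 0 y N * G (real N) y \<le> max 0 (G (real N) y)"
      using R01[OF that, of N]
      by (cases "G (real N) y \<ge> 0") (auto simp: mult_left_le_one_le mult_nonneg_nonpos max_def)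
    thus False using G0[OF that, of N] * by auto
  qed
  have L1: "L \<ge> 1" "L' \<ge> 1"
    using tendsto_lowerbound[OF seq[OF L, of 0], of 1] tendsto_lowerbound[OF seq[OF L', of 0], of 1] G1 assms
    by auto
  \<comment> \<open>The products started at \<open>x\<close> and \<open>-x\<close> are those started at \<open>0\<close>, with the signs of \<open>e\<close> exchanged.\<close>
  have RR: "R x x N * R (-x) (-x) N = R 0 x N * R 0 (-x) N" for N
    unfolding R_def prod.distrib[symmetric]
  proof (rule prod.cong[OF refl])
    fix n
    have s: "quad (- x) x (x\<^sup>2) n = quad 0 (- x) (x\<^sup>2) n" "quad x (- x) (x\<^sup>2) n = quad 0 x (x\<^sup>2) n"
      by (simp_all add: quad_def power2_eq_square algebra_simps)
    show "(1 - x\<^sup>2 / quad x (- x) (x\<^sup>2) n) * (1 - (- x)\<^sup>2 / quad (- x) (- (- x)) ((- x)\<^sup>2) n) =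
         (1 - x\<^sup>2 / quad 0 (- x) (x\<^sup>2) n) * (1 - (- x)\<^sup>2 / quad 0 (- (- x)) ((- x)\<^sup>2) n)"
      by (simp add: s mult.commute)
  qed
  have eq: "(G x x * G (-x) (-x)) * (G (0 + real N) x * G (0 + real N) (-x)) =
      G (x + real N) x * G (-x + real N) (-x)" for N
  proof -
    have "(G x x * G (-x) (-x)) * (G (0 + real N) x * G (0 + real N) (-x)) =
      (R x x N * R (-x) (-x) N) * (G (x + real N) x * G (-x + real N) (-x)) * (G (real N) x * G (real N) (-x))"
      using Gx[of x N] Gx[of "-x" N] assms by (simp add: mult_ac)
    also have "\<dots> = (R 0 x N * G (real N) x) * (R 0 (-x) N * G (real N) (-x)) * (G (x + real N) x * G (-x + real N) (-x))"
      unfolding RR by (simp add: mult_ac)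
    finally show ?thesis using G0[of x N] G0[of "-x" N] assms by simp
  qed
  have "(\<lambda>N. (G x x * G (-x) (-x)) * (G (0 + real N) x * G (0 + real N) (-x))) \<longlonglongrightarrow>
      (G x x * G (-x) (-x)) * (L * L')"
    by (intro tendsto_intros seq[OF L] seq[OF L'])
  moreover have "(\<lambda>N. G (x + real N) x * G (-x + real N) (-x)) \<longlonglongrightarrow> L * L'"
    by (intro tendsto_intros seq[OF L] seq[OF L'])
  ultimately have "(G x x * G (-x) (-x)) * (L * L') = L * L'"
    unfolding eq using LIMSEQ_unique by blast
  thus ?thesis using L1 by (simp add: cubic_family_def G_def)
qed

section \<open>Differentiating series of finite products\<close>

lemma prod_list_near_1:
  fixes zs :: "real list"
  assumes "\<And>z. z \<in> set zs \<Longrightarrow> \<bar>z - 1\<bar> \<le> \<epsilon>" "\<epsilon> \<ge> 0"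
  shows "\<bar>prod_list zs - 1\<bar> \<le> real (length zs) * \<epsilon> * (1 + \<epsilon>) ^ length zs"
  using assms(1)
proof (induction zs)
  case (Cons z zs)
  define n where "n = length zs"
  have IH: "\<bar>prod_list zs - 1\<bar> \<le> real n * \<epsilon> * (1 + \<epsilon>) ^ n" using Cons by (simp add: n_def)
  have z: "\<bar>z - 1\<bar> \<le> \<epsilon>" "\<bar>z\<bar> \<le> 1 + \<epsilon>" using Cons.prems[of z] by auto
  have 1: "1 \<le> (1 + \<epsilon>) ^ Suc n" using assms(2) by (intro one_le_power) auto
  have "prod_list (z # zs) - 1 = z * (prod_list zs - 1) + (z - 1)" by (simp add: algebra_simps)
  also have "\<bar>\<dots>\<bar> \<le> \<bar>z\<bar> * \<bar>prod_list zs - 1\<bar> + \<bar>z - 1\<bar>"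
    by (metis abs_mult abs_triangle_ineq)
  also have "\<dots> \<le> (1 + \<epsilon>) * (real n * \<epsilon> * (1 + \<epsilon>) ^ n) + \<epsilon> * (1 + \<epsilon>) ^ Suc n"
    using z IH assms(2) mult_left_mono[OF 1, of \<epsilon>] by (intro add_mono mult_mono) auto
  also have "\<dots> = real (length (z # zs)) * \<epsilon> * (1 + \<epsilon>) ^ length (z # zs)"
    by (simp add: n_def algebra_simps)
  finally show ?case .
qed auto

definition rational_prod :: "real list \<Rightarrow> real list \<Rightarrow> real \<Rightarrow> real" where
  "rational_prod as bs y = (\<Prod>a\<leftarrow>as. 1 + a * y) / (\<Prod>b\<leftarrow>bs. 1 + b * y)"

lemma prod_list_map_inverse:
  "(\<Prod>b\<leftarrow>bs. inverse (f b)) = inverse (\<Prod>b\<leftarrow>bs. f b :: real)"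
  by (induction bs) auto

text \<open>
  At most \<open>2k + 4\<close> factors, each within \<open>16 |y|\<close> of 1. For \<open>|y| \<le> 1/64\<close> the growth rate is
  \<open>(5/4)^2\<close> from the product and another \<open>5/4\<close> that absorbs the factor \<open>2k + 4\<close>; together this is
  \<open>125/64 < 4\<close>, so that weights of size \<open>(1/4)^k\<close> still lead to a convergent series.
\<close>
lemma rational_prod_near_1:
  assumes "length as \<le> k + 2" "length bs \<le> k + 2" "\<forall>c \<in> set as \<union> set bs. \<bar>c\<bar> \<le> 8"
    and y: "\<bar>y\<bar> \<le> 1/64"
  shows "\<bar>rational_prod as bs y - 1\<bar> \<le> \<bar>y\<bar> * (313 * (125/64) ^ k)"
proof -
  define zs where "zs = map (\<lambda>a. 1 + a * y) as @ map (\<lambda>b. inverse (1 + b * y)) bs"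
  define n where "n = length zs"
  have n: "n \<le> 2 * k + 4" using assms(1,2) by (simp add: n_def zs_def)
  have cy: "\<bar>c * y\<bar> \<le> 8 * \<bar>y\<bar>" if "c \<in> set as \<union> set bs" for c
    using assms(3) that by (auto simp: abs_mult intro!: mult_right_mono)
  have near: "\<bar>z - 1\<bar> \<le> 16 * \<bar>y\<bar>" if z: "z \<in> set zs" for z
  proof -
    consider a where "a \<in> set as" "z = 1 + a * y" | b where "b \<in> set bs" "z = inverse (1 + b * y)"
      using z by (auto simp: zs_def)
    thus ?thesis
    proof cases
      case 1
      thus ?thesis using cy[of a] by auto
    next
      case 2
      have b: "\<bar>b * y\<bar> \<le> 8 * \<bar>y\<bar>" using cy[of b] 2 by auto
      hence p: "1 + b * y \<ge> 1/2" using y by linarith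
      hence "z - 1 = - (b * y) / (1 + b * y)" using 2 by (simp add: field_simps)
      hence "\<bar>z - 1\<bar> = \<bar>b * y\<bar> / (1 + b * y)" using p by (simp add: abs_divide)
      also have "\<dots> \<le> (8 * \<bar>y\<bar>) / (1/2)" using b p by (intro frac_le) auto
      finally show ?thesis by simp
    qed
  qed
  have "rational_prod as bs y = prod_list zs"
    by (simp add: rational_prod_def zs_def prod_list_map_inverse divide_inverse)
  hence "\<bar>rational_prod as bs y - 1\<bar> \<le> real n * (16 * \<bar>y\<bar>) * (1 + 16 * \<bar>y\<bar>) ^ n"
    using prod_list_near_1[of zs "16 * \<bar>y\<bar>"] near by (simp add: n_def)
  also have "\<dots> \<le> real (2 * k + 4) * (16 * \<bar>y\<bar>) * (5/4) ^ (2 * k + 4)"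
  proof (intro mult_mono)
    have "(1 + 16 * \<bar>y\<bar>) ^ n \<le> (5/4) ^ n" using y by (intro power_mono) auto
    also have "\<dots> \<le> (5/4) ^ (2 * k + 4)" using n by (intro power_increasing) auto
    finally show "(1 + 16 * \<bar>y\<bar>) ^ n \<le> (5/4) ^ (2 * k + 4)" .
  qed (use n in auto)
  also have "\<dots> \<le> (8 * (5/4) ^ k) * (16 * \<bar>y\<bar>) * (5/4) ^ (2 * k + 4)"
  proof (intro mult_right_mono)
    have "1 + real k * (1/4) \<le> (1 + 1/4) ^ k" by (rule Bernoulli_inequality) auto
    thus "real (2 * k + 4) \<le> 8 * (5/4) ^ k" by simp
  qed auto
  also have "\<dots> = \<bar>y\<bar> * (128 * (625/256) * ((5/4) * (5/4)^2) ^ k)"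
  proof -
    have "(5/4 :: real) ^ (2 * k + 4) = ((5/4)^2) ^ k * (625/256)"
      by (simp add: power_add power_mult power4_eq_xxxx)
    thus ?thesis unfolding power_mult_distrib[of "5/4 :: real"] by (simp only: mult_ac)
  qed
  also have "\<dots> \<le> \<bar>y\<bar> * (313 * (125/64) ^ k)"
    by (intro mult_left_mono mult_mono) (auto simp: power2_eq_square)
  finally show ?thesis .
qed

lemma prod_list_map_1: "(\<Prod>a\<leftarrow>as. 1 :: real) = 1"
  by (induction as) auto

lemma has_real_derivative_linear_prod_list:
  "((\<lambda>y. \<Prod>a\<leftarrow>as. 1 + a * y) has_real_derivative sum_list as) (at 0)"
proof (induction as)
  case (Cons a as)
  have "((\<lambda>y. (1 + a * y) * (\<Prod>a\<leftarrow>as. 1 + a * y)) has_real_derivative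
      (a * (\<Prod>a\<leftarrow>as. 1 + a * 0) + sum_list as * (1 + a * 0))) (at 0)"
    by (intro DERIV_mult Cons.IH) (auto intro!: derivative_eq_intros)
  thus ?case by (simp add: prod_list_map_1)
qed auto

lemma has_real_derivative_rational_prod:
  "(rational_prod as bs has_real_derivative (sum_list as - sum_list bs)) (at 0)"
proof -
  have "((\<lambda>y. (\<Prod>a\<leftarrow>as. 1 + a * y) / (\<Prod>b\<leftarrow>bs. 1 + b * y)) has_real_derivative
     (sum_list as * (\<Prod>b\<leftarrow>bs. 1 + b * 0) - (\<Prod>a\<leftarrow>as. 1 + a * 0) * sum_list bs) /
     ((\<Prod>b\<leftarrow>bs. 1 + b * 0) * (\<Prod>b\<leftarrow>bs. 1 + b * 0))) (at 0)"
    by (intro DERIV_divide has_real_derivative_linear_prod_list) (simp add: prod_list_map_1)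
  thus ?thesis by (simp add: rational_prod_def[abs_def] prod_list_map_1)
qed

text \<open>
  The difference quotients are dominated by a geometric series uniformly in \<open>y\<close>, so Tannery's theorem
  allows the derivative at 0 to be taken term by term.
\<close>
lemma rational_prod_series_derivative:
  fixes T :: "nat \<Rightarrow> real"
  assumes len: "\<And>k. length (as k) \<le> k + 2" "\<And>k. length (bs k) \<le> k + 2"
    and coeff: "\<And>k. \<forall>c \<in> set (as k) \<union> set (bs k). \<bar>c\<bar> \<le> 8"
    and T: "\<And>k. 0 \<le> T k" "\<And>k. T k \<le> 16 * (1/4) ^ k"
  defines "F \<equiv> (\<lambda>y. \<Sum>k. T k * rational_prod (as k) (bs k) y)"
  defines "d \<equiv> (\<lambda>k. T k * (sum_list (as k) - sum_list (bs k)))"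
  shows "summable d"
    and "\<And>y. \<bar>y\<bar> \<le> 1/64 \<Longrightarrow> summable (\<lambda>k. T k * rational_prod (as k) (bs k) y)"
    and "((\<lambda>y. (F y - F 0) / y) \<longlongrightarrow> suminf d) (at 0)"
proof -
  define M where "M = (\<lambda>k. 5008 * (125/256 :: real) ^ k)"
  have M: "summable M" unfolding M_def by (intro summable_mult summable_geometric) auto
  have Tsum: "summable T"
  proof (rule summable_comparison_test')
    show "summable (\<lambda>k. 16 * (1/4 :: real) ^ k)" by (intro summable_mult summable_geometric) auto
  qed (use T in auto)
  have rp0: "rational_prod (as k) (bs k) 0 = 1" for k by (simp add: rational_prod_def prod_list_map_1)
  have bound: "\<bar>T k * (rational_prod (as k) (bs k) y - 1)\<bar> \<le> \<bar>y\<bar> * M k" if "\<bar>y\<bar> \<le> 1/64" for y k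
  proof -
    have "\<bar>T k * (rational_prod (as k) (bs k) y - 1)\<bar> \<le> (16 * (1/4) ^ k) * (\<bar>y\<bar> * (313 * (125/64) ^ k))"
      unfolding abs_mult using rational_prod_near_1[OF len(1)[of k] len(2)[of k] coeff[of k] that] T[of k] by (intro mult_mono) auto
    also have "\<dots> = \<bar>y\<bar> * (5008 * ((1/4) * (125/64)) ^ k)" unfolding power_mult_distrib by simp
    finally show ?thesis by (simp add: M_def)
  qed
  have sum1: "summable (\<lambda>k. T k * (rational_prod (as k) (bs k) y - 1))" if "\<bar>y\<bar> \<le> 1/64" for y
    by (rule summable_comparison_test'[OF summable_mult[OF M, of "\<bar>y\<bar>"]]) (use bound[OF that] in auto)
  show sum2: "summable (\<lambda>k. T k * rational_prod (as k) (bs k) y)" if "\<bar>y\<bar> \<le> 1/64" for y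
    using summable_add[OF sum1[OF that] Tsum] by (simp add: algebra_simps)
  have lim: "((\<lambda>y. T k * (rational_prod (as k) (bs k) y - 1) / y) \<longlongrightarrow> d k) (at 0)" for k
  proof -
    have "((\<lambda>y. (rational_prod (as k) (bs k) y - 1) / y) \<longlongrightarrow> sum_list (as k) - sum_list (bs k)) (at 0)"
      using has_real_derivative_rational_prod[of "as k" "bs k"] by (simp add: has_field_derivative_iff rp0)
    from tendsto_mult_left[OF this, of "T k"] show ?thesis by (simp add: d_def)
  qed
  have dom: "eventually (\<lambda>(k, y). norm (T k * (rational_prod (as k) (bs k) y - 1) / y) \<le> M k) (at_top \<times>\<^sub>F at 0)"
    unfolding eventually_prod_filter
  proof (intro exI[of _ "\<lambda>_::nat. True"] exI[of _ "\<lambda>y. \<bar>y\<bar> \<le> 1/64 \<and> y \<noteq> 0"] conjI allI impI)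
    show "eventually (\<lambda>y. \<bar>y\<bar> \<le> 1/64 \<and> y \<noteq> 0) (at (0::real))"
      by (auto simp: eventually_at intro!: exI[of _ "1/64"])
    fix k and y :: real assume "\<bar>y\<bar> \<le> 1/64 \<and> y \<noteq> 0"
    thus "case (k, y) of (k, y) \<Rightarrow> norm (T k * (rational_prod (as k) (bs k) y - 1) / y) \<le> M k"
      using bound[of y k] by (simp add: abs_divide divide_le_eq mult.commute)
  qed auto
  note tan = tannerys_theorem[OF lim dom M at_neq_bot]
  show "summable d" using tan summable_norm_cancel by blast
  have ev: "eventually (\<lambda>y. (\<Sum>k. T k * (rational_prod (as k) (bs k) y - 1) / y) = (F y - F 0) / y) (at 0)"
    unfolding eventually_at
  proof (intro exI[of _ "1/64"] conjI ballI impI)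
    fix y :: real assume "y \<noteq> 0 \<and> dist y 0 < 1/64"
    hence y: "\<bar>y\<bar> \<le> 1/64" "y \<noteq> 0" by auto
    have "(\<Sum>k. T k * (rational_prod (as k) (bs k) y - 1) / y) = (\<Sum>k. T k * (rational_prod (as k) (bs k) y - 1)) / y"
      by (rule suminf_divide[OF sum1[OF y(1)]])
    also have "(\<Sum>k. T k * (rational_prod (as k) (bs k) y - 1)) = F y - F 0"
      unfolding F_def using suminf_diff[OF sum2[OF y(1)] Tsum] by (simp add: rp0 right_diff_distrib)
    finally show "(\<Sum>k. T k * (rational_prod (as k) (bs k) y - 1) / y) = (F y - F 0) / y" .
  qed auto
  show "((\<lambda>y. (F y - F 0) / y) \<longlongrightarrow> suminf d) (at 0)"
    using tan by (blast intro: Lim_transform_eventually[OF _ ev])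
qed

section \<open>Power sums over half-integers\<close>

text \<open>
  Remove the even terms, which contribute \<open>zeta p / 2^p\<close>, from the zeta series.
\<close>
lemma half_integer_power_sums:
  assumes "p > 1"
  shows "(\<lambda>n. 1 / (real n + 1/2) ^ p) sums ((2 ^ p - 1) * zeta (real p))"
proof -
  define f where "f n = 1 / real (Suc n) ^ p" for n
  have "summable (\<lambda>n. inverse (real (Suc n) ^ p))"
    using inverse_power_summable[of p, where 'a = real] assms by (subst summable_Suc_iff) auto
  hence sf: "summable f" by (simp add: f_def[abs_def] inverse_eq_divide)
  have z: "zeta (real p) = suminf f"
    by (simp add: zeta_def f_def[abs_def] powr_realpow del: of_nat_Suc)
  have S: "f sums zeta (real p)" unfolding z by (rule summable_sums[OF sf])
  have "(\<lambda>n. sum f {n * 2..<n * 2 + 2}) sums zeta (real p)"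
    by (rule sums_group[OF S]) simp
  moreover have "sum f {n * 2..<n * 2 + 2} = f (2 * n) + f (2 * n + 1)" for n
    by (simp add: numeral_2_eq_2 mult.commute)
  moreover have "f (2 * n + 1) = 1 / 2 ^ p * f n" for n
  proof -
    have "real (Suc (2 * n + 1)) = 2 * real (Suc n)" by simp
    thus ?thesis unfolding f_def by (simp only: power_mult_distrib) simp
  qed
  ultimately have "(\<lambda>n. f (2 * n) + 1 / 2 ^ p * f n) sums zeta (real p)" by simp
  from sums_diff[OF this sums_mult[OF S, of "1 / 2 ^ p"]]
  have "(\<lambda>n. f (2 * n)) sums (zeta (real p) - 1 / 2 ^ p * zeta (real p))" by simp
  from sums_mult[OF this, of "2 ^ p"]
  have "(\<lambda>n. 2 ^ p * f (2 * n)) sums ((2 ^ p - 1) * zeta (real p))" by (simp add: algebra_simps)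
  moreover have "2 ^ p * f (2 * n) = 1 / (real n + 1/2) ^ p" for n
  proof -
    have "real (Suc (2 * n)) = 2 * (real n + 1/2)" by simp
    thus ?thesis unfolding f_def by (simp only: power_mult_distrib) simp
  qed
  ultimately show ?thesis by simp
qed

lemma cos_pi_pos:
  assumes "\<bar>x\<bar> < 1/2"
  shows "cos (pi * x) > 0"
proof -
  have "\<bar>pi * x\<bar> < pi * (1/2)"
    using mult_strict_left_mono[OF assms pi_gt_zero] by (simp add: abs_mult)
  hence "pi * x < pi / 2" "- (pi / 2) < pi * x" by linarith+
  thus ?thesis by (intro cos_gt_zero_pi)
qed

text \<open>
  The reflection formula centred at 1/2. Its logarithmic derivative, differentiated three more
  times, becomes the value of the sum of \<open>1 / (n + 1/2)^4\<close> at the centre.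
\<close>
lemma Gamma_reflection_cos:
  fixes x :: real
  assumes "\<bar>x\<bar> < 1/2"
  shows "Gamma (1/2 + x) * Gamma (1/2 - x) * cos (pi * x) = pi"
proof -
  have "complex_of_real (Gamma (1/2 + x) * Gamma (1/2 - x)) = Gamma (of_real (1/2 + x)) * Gamma (of_real (1/2 - x))"
    by (simp only: of_real_mult Gamma_complex_of_real)
  also have "complex_of_real (1/2 - x) = 1 - of_real (1/2 + x)" by simp
  also have "Gamma (complex_of_real (1/2 + x)) * Gamma (1 - complex_of_real (1/2 + x)) =
      of_real pi / sin (of_real pi * of_real (1/2 + x))"
    by (rule Gamma_reflection_complex)
  also have "\<dots> = of_real (pi / sin (pi * (1/2 + x)))" by (simp only: of_real_mult[symmetric] sin_of_real of_real_divide)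
  also have "sin (pi * (1/2 + x)) = cos (pi * x)" by (simp add: distrib_left sin_add)
  finally have "Gamma (1/2 + x) * Gamma (1/2 - x) = pi / cos (pi * x)"
    by (simp only: of_real_eq_iff)
  thus ?thesis using cos_pi_pos[OF assms] by simp
qed

lemma half_strip_not_nonpos_Ints:
  fixes x :: real
  assumes "\<bar>x\<bar> < 1/2"
  shows "1/2 + x \<notin> \<int>\<^sub>\<le>\<^sub>0" "1/2 - x \<notin> \<int>\<^sub>\<le>\<^sub>0"
  using assms nonpos_Ints_nonpos[of "1/2 + x"] nonpos_Ints_nonpos[of "1/2 - x"] by auto

text \<open>
  Differentiation of an identity between functions that is only known on the interval \<open>|x| < 1/2\<close>.
\<close>
lemma derivatives_eq_on_half_strip:
  fixes f g :: "real \<Rightarrow> real"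
  assumes "\<And>x. \<bar>x\<bar> < 1/2 \<Longrightarrow> f x = g x"
    and "\<And>x. \<bar>x\<bar> < 1/2 \<Longrightarrow> (f has_real_derivative f' x) (at x)"
    and "\<And>x. \<bar>x\<bar> < 1/2 \<Longrightarrow> (g has_real_derivative g' x) (at x)"
    and "\<bar>x\<bar> < 1/2"
  shows "f' x = g' x"
proof -
  have "open {y::real. \<bar>y\<bar> < 1/2}" by (intro open_Collect_less continuous_intros)
  hence "(f has_real_derivative g' x) (at x)"
    using assms has_field_derivative_transform_within_open[of g "g' x" x "{y. \<bar>y\<bar> < 1/2}" f] by auto
  thus ?thesis using assms(2,4) DERIV_unique by blast
qed

lemma tan_pi_derivative:
  assumes "\<bar>x\<bar> < 1/2"
  shows "((\<lambda>x. tan (pi * x)) has_real_derivative pi * (1 + tan (pi * x) ^ 2)) (at x)"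
proof -
  have c: "cos (pi * x) \<noteq> 0"
    using cos_pi_pos[OF assms] by simp
  have "((\<lambda>x. tan (pi * x)) has_real_derivative inverse (cos (pi * x) ^ 2) * pi) (at x)"
    using c by (auto intro!: derivative_eq_intros)
  also have "inverse (cos (pi * x) ^ 2) * pi = pi * (1 + tan (pi * x) ^ 2)"
    using c by (simp add: tan_sec mult.commute power_inverse)
  finally show ?thesis .
qed

lemma Digamma_reflection_tan:
  fixes x :: real
  assumes "\<bar>x\<bar> < 1/2"
  shows "Digamma (1/2 + x) - Digamma (1/2 - x) = pi * tan (pi * x)"
proof -
  let ?G = "\<lambda>x. Gamma (1/2 + x) * Gamma (1/2 - x) * cos (pi * x)"
  let ?G' = "\<lambda>x. Gamma (1/2 + x) * Gamma (1/2 - x) *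
     ((Digamma (1/2 + x) - Digamma (1/2 - x)) * cos (pi * x) - pi * sin (pi * x))"
  have "?G' x = 0"
  proof (rule derivatives_eq_on_half_strip[of ?G "\<lambda>_. pi" ?G' "\<lambda>_. 0"])
    fix x :: real assume x: "\<bar>x\<bar> < 1/2"
    note h = half_strip_not_nonpos_Ints[OF x]
    have "((\<lambda>x. Gamma (1/2 + x)) has_real_derivative Gamma (1/2 + x) * Digamma (1/2 + x) * 1) (at x)"
      by (rule DERIV_chain2[where f = Gamma and g = "\<lambda>x. 1/2 + x", OF has_field_derivative_Gamma[OF h(1)]])
         (auto intro!: derivative_eq_intros)
    moreover have "((\<lambda>x. Gamma (1/2 - x)) has_real_derivative Gamma (1/2 - x) * Digamma (1/2 - x) * (-1)) (at x)"
      by (rule DERIV_chain2[where f = Gamma and g = "\<lambda>x. 1/2 - x", OF has_field_derivative_Gamma[OF h(2)]])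
         (auto intro!: derivative_eq_intros)
    moreover have "((\<lambda>x. cos (pi * x)) has_real_derivative - (pi * sin (pi * x))) (at x)"
      by (auto intro!: derivative_eq_intros)
    ultimately show "(?G has_real_derivative ?G' x) (at x)"
    proof (rule DERIV_cong[OF DERIV_mult[OF DERIV_mult]])
      have "(A * a * 1 * B + B * b * (-1) * A) * c + - s * (A * B) = A * B * ((a - b) * c - s)"
        for A B a b c s :: real by (simp add: algebra_simps)
      thus "(Gamma (1/2 + x) * Digamma (1/2 + x) * 1 * Gamma (1/2 - x) +
          Gamma (1/2 - x) * Digamma (1/2 - x) * (-1) * Gamma (1/2 + x)) * cos (pi * x) +
          - (pi * sin (pi * x)) * (Gamma (1/2 + x) * Gamma (1/2 - x)) =
          Gamma (1/2 + x) * Gamma (1/2 - x) *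
          ((Digamma (1/2 + x) - Digamma (1/2 - x)) * cos (pi * x) - pi * sin (pi * x))" .
    qed
  qed (use assms Gamma_reflection_cos in auto)
  moreover have "Gamma (1/2 + x) \<noteq> 0" "Gamma (1/2 - x) \<noteq> 0"
    using half_strip_not_nonpos_Ints[OF assms] by (auto simp: Gamma_eq_zero_iff)
  moreover have "cos (pi * x) \<noteq> 0"
    using cos_pi_pos[OF assms] by simp
  ultimately have "(Digamma (1/2 + x) - Digamma (1/2 - x)) * cos (pi * x) = pi * sin (pi * x)"
    by (simp only: mult_eq_0_iff) simp
  thus ?thesis using cos_pi_pos[OF assms] by (simp add: tan_def eq_divide_eq)
qed

lemma Polygamma_half_strip_derivative:
  fixes x :: real
  assumes "\<bar>x\<bar> < 1/2"
  shows "((\<lambda>x. Polygamma n (1/2 + x)) has_real_derivative Polygamma (Suc n) (1/2 + x)) (at x)"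
    and "((\<lambda>x. Polygamma n (1/2 - x)) has_real_derivative - Polygamma (Suc n) (1/2 - x)) (at x)"
proof -
  note h = half_strip_not_nonpos_Ints[OF assms]
  have "((\<lambda>x. Polygamma n (1/2 + x)) has_real_derivative Polygamma (Suc n) (1/2 + x) * 1) (at x)"
    by (rule DERIV_chain2[where f = "Polygamma n" and g = "\<lambda>x. 1/2 + x",
          OF has_field_derivative_Polygamma[OF h(1)]]) (auto intro!: derivative_eq_intros)
  thus "((\<lambda>x. Polygamma n (1/2 + x)) has_real_derivative Polygamma (Suc n) (1/2 + x)) (at x)"
    by simp
  have "((\<lambda>x. Polygamma n (1/2 - x)) has_real_derivative Polygamma (Suc n) (1/2 - x) * (-1)) (at x)"
    by (rule DERIV_chain2[where f = "Polygamma n" and g = "\<lambda>x. 1/2 - x",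
          OF has_field_derivative_Polygamma[OF h(2)]]) (auto intro!: derivative_eq_intros)
  thus "((\<lambda>x. Polygamma n (1/2 - x)) has_real_derivative - Polygamma (Suc n) (1/2 - x)) (at x)"
    by simp
qed

text \<open>
  Starting from the tangent form of the reflection formula, three differentiations in terms of
  \<open>t = tan (pi x)\<close>, with \<open>t' = pi (1 + t^2)\<close>, give
  \<open>2 pi^4 (1 + t^2) (1 + 3 t^2)\<close>, which is evaluated at \<open>x = 0\<close>.
\<close>
lemma Polygamma_3_half: "Polygamma 3 (1/2 :: real) = pi ^ 4"
proof -
  define t where "t = (\<lambda>x. tan (pi * x))"
  define d where "d n = (\<lambda>x::real. Polygamma n (1/2 + x) + (-1) ^ Suc n * Polygamma n (1/2 - x))" for n
  have dd: "(d n has_real_derivative d (Suc n) x) (at x)" if "\<bar>x\<bar> < 1/2" for n x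
    using DERIV_add[OF Polygamma_half_strip_derivative(1)[OF that, of n]
        DERIV_cmult[OF Polygamma_half_strip_derivative(2)[OF that, of n], of "(-1) ^ Suc n"]]
    by (simp add: d_def)
  have t': "(t has_real_derivative pi * (1 + t x ^ 2)) (at x)" if "\<bar>x\<bar> < 1/2" for x
    unfolding t_def by (rule tan_pi_derivative[OF that])
  have 0: "d 0 x = pi * t x" if "\<bar>x\<bar> < 1/2" for x
    using Digamma_reflection_tan[OF that] by (simp add: d_def t_def)
  have 1: "d 1 x = pi ^ 2 * (1 + t x ^ 2)" if "\<bar>x\<bar> < 1/2" for x
    unfolding One_nat_def
    by (rule derivatives_eq_on_half_strip[OF 0 dd _ that])
       (auto intro!: derivative_eq_intros t' simp: power2_eq_square algebra_simps)
  have 2: "d 2 x = 2 * pi ^ 3 * (t x + t x ^ 3)" if "\<bar>x\<bar> < 1/2" for x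
    unfolding numeral_2_eq_2 One_nat_def[symmetric]
    by (rule derivatives_eq_on_half_strip[OF 1 dd _ that])
       (auto intro!: derivative_eq_intros t' simp: power2_eq_square power3_eq_cube algebra_simps)
  have 3: "d 3 x = 2 * pi ^ 4 * (1 + t x ^ 2) * (1 + 3 * t x ^ 2)" if "\<bar>x\<bar> < 1/2" for x
    unfolding eval_nat_numeral(3)[of num.One]
    by (rule derivatives_eq_on_half_strip[OF 2 dd _ that])
       (auto intro!: derivative_eq_intros t' simp: power2_eq_square power3_eq_cube power4_eq_xxxx algebra_simps)
  show ?thesis using 3[of 0] by (simp add: d_def t_def)
qed

lemma half_integer_fourth_power_sums: "(\<lambda>n. 1 / (real n + 1/2) ^ 4) sums (pi ^ 4 / 6)"
proof -
  have "(\<lambda>k. inverse ((1/2 + real k) ^ Suc 3)) sums ((- 1) ^ Suc 3 * Polygamma 3 (1/2 :: real) / fact 3)"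
    by (rule Polygamma_LIMSEQ) auto
  thus ?thesis by (simp add: Polygamma_3_half inverse_eq_divide add.commute fact_numeral)
qed

section \<open>The three one-parameter families\<close>

definition base_term :: "nat \<Rightarrow> real" where
  "base_term k = summand 0 0 0 k"

definition node :: "nat \<Rightarrow> real" where "node j = real j + 1/2"

lemma base_ratio: "ratio 0 0 0 j = (real j + 1)\<^sup>2 / (4 * (real j + 3/2)\<^sup>2)"
proof -
  have "ratio 0 0 0 j = (1 + real j) * (1/2 + real j) / (real j + 3/2)\<^sup>2 * (real j + 1)\<^sup>2 / (4 * (1/2 + real j) * (real j + 1))"
    by (simp add: ratio_def quad_def add_ac)
  also have "\<dots> = (real j + 1)\<^sup>2 / (4 * (real j + 3/2)\<^sup>2)"
  proof -
    have gen: "(1 + real j) * h / q * p / (4 * h * (real j + 1)) = p / (4 * q)" if "h > 0" for h q p :: real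
    proof -
      have "(1 + real j) * h / q * p / (4 * h * (real j + 1)) = ((h * (real j + 1)) * p) / ((h * (real j + 1)) * (4 * q))"
        by (simp add: mult_ac add_ac)
      also have "\<dots> = p / (4 * q)" using that by (intro mult_divide_mult_cancel_left) auto
      finally show ?thesis .
    qed
    show ?thesis by (rule gen) simp
  qed
  finally show ?thesis .
qed

lemma base_wz_cert_bounds: "0 \<le> wz_cert 0 0 0 k" "wz_cert 0 0 0 k \<le> 4 * (1/4) ^ k"
proof -
  have "wz_cert 0 0 0 k \<ge> 0 \<and> wz_cert 0 0 0 k \<le> 4 * (1/4) ^ k"
  proof (induction k)
    case 0
    show ?case by (simp add: wz_cert_0 quad_def power2_eq_square)
  next
    case (Suc k)
    have "(real k + 1)\<^sup>2 \<le> (real k + 3/2)\<^sup>2" by (intro power_mono) auto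
    hence "ratio 0 0 0 k \<le> 1/4" "ratio 0 0 0 k \<ge> 0" unfolding base_ratio by (auto simp: divide_simps)
    hence "wz_cert 0 0 0 k * ratio 0 0 0 k \<le> (4 * (1/4) ^ k) * (1/4)"
      using Suc.IH by (intro mult_mono) auto
    moreover have "wz_cert 0 0 0 k * ratio 0 0 0 k \<ge> 0"
      using Suc.IH \<open>ratio 0 0 0 k \<ge> 0\<close> by (intro mult_nonneg_nonneg) auto
    ultimately show ?case by (simp add: wz_cert_Suc)
  qed
  thus "0 \<le> wz_cert 0 0 0 k" "wz_cert 0 0 0 k \<le> 4 * (1/4) ^ k" by auto
qed

lemma base_term_bounds: "0 \<le> base_term k" "base_term k \<le> 16 * (1/4) ^ k"
proof -
  have r: "base_term k = wz_cert 0 0 0 k * ((3 * real k + 2) / ((1/2 + real k) * (real k + 1)))"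
    by (simp add: base_term_def summand_def)
  show "0 \<le> base_term k" unfolding r using base_wz_cert_bounds(1) by simp
  have "3 * real k + 2 \<le> 4 * ((1/2 + real k) * 1)" by simp
  also have "\<dots> \<le> 4 * ((1/2 + real k) * (real k + 1))" by (intro mult_left_mono) auto
  finally have "(3 * real k + 2) / ((1/2 + real k) * (real k + 1)) \<le> 4"
    by (subst divide_le_eq) (auto intro!: mult_pos_pos)
  hence "base_term k \<le> (4 * (1/4) ^ k) * 4" unfolding r using base_wz_cert_bounds by (intro mult_mono) auto
  thus "base_term k \<le> 16 * (1/4) ^ k" by simp
qed

text \<open>
  Both sides satisfy the same first-order recurrence in \<open>k\<close>; the central binomial coefficient enters
  through \<open>(1/2)\<^sub>k = k! (2k choose k) / 4^k\<close>.
\<close>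
lemma wz_cert_central_binomial:
  "wz_cert 0 0 0 k * real (Suc k) ^ 2 * real ((2 * Suc k) choose (Suc k)) ^ 2 = 4 * 4 ^ Suc k"
proof (induction k)
  case 0
  show ?case by (simp add: wz_cert_0 quad_def power2_eq_square)
next
  case (Suc k)
  define K where "K = Suc k"
  define b where "b = real ((2 * K) choose K)"
  have K: "real K > 0" by (simp add: K_def)
  have c: "real ((2 * Suc K) choose (Suc K)) = b * (2 * (2 * real K + 1)) / (real K + 1)"
  proof -
    have central: "real ((2 * n) choose n) = fact (2 * n) / (fact n * fact n)" for n
      using binomial_fact[of n "2 * n", where 'a = real] by (simp add: mult_2)
    have gen: "(2 * r * g * F) / ((r * h) * (r * h)) = F / (h * h) * (2 * g) / r"
      if "r > 0" for r g F h :: real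
      using that by (simp add: mult_ac)
    have "(fact (2 * Suc K) :: real) = 2 * (real K + 1) * (2 * real K + 1) * fact (2 * K)"
      by (simp add: algebra_simps)
    moreover have "(fact (Suc K) :: real) = (real K + 1) * fact K" by (simp add: algebra_simps)
    moreover have "2 * (real K + 1) * (2 * real K + 1) * fact (2 * K) / ((real K + 1) * fact K * ((real K + 1) * fact K))
        = fact (2 * K) / (fact K * fact K) * (2 * (2 * real K + 1)) / (real K + 1)"
      by (rule gen) (use K in linarith)
    ultimately show ?thesis unfolding b_def central by (simp only:)
  qed
  have r: "ratio 0 0 0 k = (real K)\<^sup>2 / (2 * real K + 1)\<^sup>2"
  proof -
    have "4 * (real k + 3/2)\<^sup>2 = (2 * real K + 1)\<^sup>2" by (simp add: K_def power2_eq_square algebra_simps)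
    thus ?thesis unfolding base_ratio by (simp add: K_def add.commute)
  qed
  have IH: "wz_cert 0 0 0 k * (real K)\<^sup>2 * b\<^sup>2 = 4 * 4 ^ K" using Suc.IH by (simp add: K_def b_def)
  have "wz_cert 0 0 0 K * (real (Suc K))\<^sup>2 * (real ((2 * Suc K) choose (Suc K)))\<^sup>2 =
     wz_cert 0 0 0 k * ((real K)\<^sup>2 / (2 * real K + 1)\<^sup>2) * (real K + 1)\<^sup>2 * (b * (2 * (2 * real K + 1)) / (real K + 1))\<^sup>2"
    unfolding c unfolding K_def wz_cert_Suc r[unfolded K_def] by (simp add: add_ac)
  also have "\<dots> = 4 * (wz_cert 0 0 0 k * (real K)\<^sup>2 * b\<^sup>2)"
  proof -
    have gen: "c * (n\<^sup>2 / g\<^sup>2) * r\<^sup>2 * (b * (2 * g) / r)\<^sup>2 = 4 * (c * n\<^sup>2 * b\<^sup>2)"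
      if "g > 0" "r > 0" for c n g r :: real
      using that by (simp add: power_mult_distrib power_divide mult_ac)
    show ?thesis by (rule gen) (use K in linarith)+
  qed
  also have "\<dots> = 4 * 4 ^ Suc K" unfolding IH by simp
  finally show ?case by (simp add: K_def)
qed

lemma base_term_central_binomial:
  "(3 * real (Suc k) - 1) * 4 ^ Suc k / ((2 * real (Suc k) - 1) * real (Suc k) ^ 3 * real ((2 * Suc k) choose Suc k) ^ 2)
    = base_term k / 8"
proof -
  define K where "K = real (Suc k)"
  define b where "b = real ((2 * Suc k) choose Suc k)"
  have K: "K > 0" "2 * K - 1 > 0" by (auto simp: K_def)
  have b: "b > 0" unfolding b_def of_nat_0_less_iff by (rule zero_less_binomial) simp
  have c: "wz_cert 0 0 0 k = 4 * 4 ^ Suc k / (K\<^sup>2 * b\<^sup>2)"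
    using wz_cert_central_binomial[of k] K b unfolding K_def[symmetric] b_def[symmetric]
    by (simp add: field_simps)
  have "base_term k = wz_cert 0 0 0 k * (3 * K - 1) / ((K - 1/2) * K)"
    by (simp add: base_term_def summand_def K_def algebra_simps)
  also have "\<dots> = 8 * ((3 * K - 1) * 4 ^ Suc k / ((2 * K - 1) * K ^ 3 * b ^ 2))"
  proof -
    have h: "K - 1/2 = (2 * K - 1) / 2" by simp
    show ?thesis unfolding c h using K b by (simp add: power2_eq_square power3_eq_cube mult_ac)
  qed
  finally have e: "base_term k = 8 * ((3 * K - 1) * 4 ^ Suc k / ((2 * K - 1) * K ^ 3 * b ^ 2))" .
  show ?thesis unfolding K_def[symmetric] b_def[symmetric] e
    by (rule nonzero_mult_div_cancel_left[symmetric]) simp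
qed

definition symm_nums :: "real \<Rightarrow> real \<Rightarrow> nat \<Rightarrow> real list" where
  "symm_nums p q k = map (\<lambda>j. p / (real j + 1) ^ 2 + q / (real j + 1) ^ 3) [0..<k]"

definition symm_dens :: "real \<Rightarrow> real \<Rightarrow> nat \<Rightarrow> real list" where
  "symm_dens p q k = map (\<lambda>j. p / node j ^ 2 + q / node j ^ 3) [0..<Suc k]"

text \<open>
  For \<open>u + e = 0\<close> the numerators \<open>(2u + j) (2v + j) (2w + j)\<close> and the denominators
  \<open>(m - u) (m - v) (m - w)\<close> are cubic polynomials in \<open>j\<close> and \<open>m\<close> without quadratic term. The
  hypotheses express that their lower coefficients are proportional to one parameter \<open>y\<close>, which holds
  with \<open>y = x^2\<close> for \<open>f = 0\<close>, and with \<open>y = x^3\<close> for \<open>f = x^2\<close>.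
\<close>
lemma antisymmetric_summand:
  fixes x f y :: real
  assumes num: "\<And>j. 4 * (f - x\<^sup>2) * (real j + 1) + 8 * x * f = y * (p * (real j + 1) + q)"
    and den: "\<And>j. (f - x\<^sup>2) * node j - x * f = y * (p' * node j + q')"
  shows "summand x (-x) f k = base_term k * rational_prod (symm_nums p q k) (symm_dens p' q' k) y"
proof -
  define N where "N j = 1 + (p / (real j + 1) ^ 2 + q / (real j + 1) ^ 3) * y" for j
  define D where "D j = 1 + (p' / node j ^ 2 + q' / node j ^ 3) * y" for j
  have node: "node j > 0" for j by (simp add: node_def)
  have N: "(2 * x + 1 + real j) * ((real j + 1)\<^sup>2 + 2 * (-x) * (real j + 1) + 4 * f) = (real j + 1) ^ 3 * N j" for j
  proof -
    have "(2 * x + 1 + real j) * ((real j + 1)\<^sup>2 + 2 * (-x) * (real j + 1) + 4 * f)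
        = (real j + 1) ^ 3 + (4 * (f - x\<^sup>2) * (real j + 1) + 8 * x * f)"
      by (simp add: power2_eq_square power3_eq_cube algebra_simps)
    also have "\<dots> = (real j + 1) ^ 3 * N j"
    proof -
      have "n ^ 3 + y * (p * n + q) = n ^ 3 * (1 + (p / n ^ 2 + q / n ^ 3) * y)" if "n > 0" for n :: real
        using that by (simp add: field_simps power2_eq_square power3_eq_cube)
      from this[of "real j + 1"] show ?thesis unfolding num N_def by simp
    qed
    finally show ?thesis .
  qed
  have D: "quad x (-x) f j * (1/2 - x + real j) = node j ^ 3 * D j" for j
  proof -
    have "quad x (-x) f j * (1/2 - x + real j) = (1/2 + real j) ^ 3 + ((f - x\<^sup>2) * (1/2 + real j) - x * f)"
      by (simp add: quad_def power2_eq_square power3_eq_cube field_simps)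
    also have "\<dots> = node j ^ 3 + ((f - x\<^sup>2) * node j - x * f)" by (simp add: node_def add.commute)
    also have "\<dots> = node j ^ 3 * D j"
      unfolding den D_def using node[of j] by (simp add: field_simps power2_eq_square power3_eq_cube)
    finally show ?thesis .
  qed
  have "wz_cert x (-x) f k / (1/2 - x + real k) = wz_cert 0 0 0 k / node k * ((\<Prod>j<k. N j) / (\<Prod>j\<le>k. D j))"
  proof (induction k)
    case 0
    have "wz_cert x (-x) f 0 / (1/2 - x + real 0) = 1 / (quad x (-x) f 0 * (1/2 - x + real 0))"
      by (simp add: wz_cert_0)
    thus ?case unfolding D by (simp add: wz_cert_0 quad_def node_def power2_eq_square power3_eq_cube)
  next
    case (Suc k)
    have "wz_cert x (-x) f (Suc k) / (1/2 - x + real (Suc k)) =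
      wz_cert x (-x) f k * ((2 * x + 1 + real k) * ((real k + 1)\<^sup>2 + 2 * (-x) * (real k + 1) + 4 * f)) * node k
       / (4 * (1/2 - x + real k) * (real k + 1) * (quad x (-x) f (Suc k) * (1/2 - x + real (Suc k))))"
      unfolding wz_cert_Suc ratio_def by (simp add: node_def mult_ac add_ac)
    also have "\<dots> = (wz_cert x (-x) f k / (1/2 - x + real k)) *
        ((real k + 1) ^ 3 * N k * node k / (4 * (real k + 1) * (node (Suc k) ^ 3 * D (Suc k))))"
    proof -
      have gen: "C * E * m / (4 * h * n * G) = (C / h) * (E * m / (4 * n * G))" for C E m h n G :: real
        by simp
      show ?thesis unfolding N D by (rule gen)
    qed
    also have "\<dots> = wz_cert 0 0 0 k * ((real k + 1)\<^sup>2 / (4 * node (Suc k) ^ 2)) / node (Suc k)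
        * ((\<Prod>j<k. N j) * N k / ((\<Prod>j\<le>k. D j) * D (Suc k)))"
    proof -
      have gen: "c / m * (P / R) * (n ^ 3 * a * m / (4 * n * (m' ^ 3 * d))) =
          c * (n\<^sup>2 / (4 * m'\<^sup>2)) / m' * (P * a / (R * d))" if "m > 0" "n > 0" for c m P R n a m' d :: real
        using that by (simp add: power2_eq_square power3_eq_cube mult_ac)
      show ?thesis unfolding Suc.IH by (rule gen) (use node in auto)
    qed
    also have "wz_cert 0 0 0 k * ((real k + 1)\<^sup>2 / (4 * node (Suc k) ^ 2)) = wz_cert 0 0 0 (Suc k)"
      unfolding wz_cert_Suc base_ratio by (simp add: node_def add_ac)
    finally show ?case by simp
  qed
  moreover have "(\<Prod>j<k. N j) / (\<Prod>j\<le>k. D j) = rational_prod (symm_nums p q k) (symm_dens p' q' k) y"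
  proof -
    have "(\<Prod>a\<leftarrow>map g [0..<n]. 1 + a * y) = (\<Prod>j<n. 1 + g j * y)" for g :: "nat \<Rightarrow> real" and n
      by (induction n) auto
    thus ?thesis unfolding rational_prod_def symm_nums_def symm_dens_def N_def D_def lessThan_Suc_atMost[symmetric]
      by (simp only:)
  qed
  ultimately have *: "wz_cert x (-x) f k / (1/2 - x + real k) =
      wz_cert 0 0 0 k / node k * rational_prod (symm_nums p q k) (symm_dens p' q' k) y" by simp
  have "summand x (-x) f k = wz_cert x (-x) f k / (1/2 - x + real k) * ((3 * real k + 2) / (real k + 1))"
    by (simp add: summand_def)
  also have "\<dots> = base_term k * rational_prod (symm_nums p q k) (symm_dens p' q' k) y"
    unfolding * by (simp add: base_term_def summand_def node_def add_ac)
  finally show ?thesis .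
qed

definition shift_nums :: "nat \<Rightarrow> real list" where
  "shift_nums k = map (\<lambda>j. 2 / (real j + 1)) [0..<k] @ [2 / (3 * real k + 2)]"

definition shift_dens :: "nat \<Rightarrow> real list" where
  "shift_dens k = map (\<lambda>j. 1 / node j) [0..<Suc k] @ [1 / node k]"

text \<open>
  For \<open>e = f = 0\<close> two of the three denominators are the product of \<open>1/2 + y + j\<close> over \<open>j \<le> k\<close>, and there
  is one numerator with the same factors for \<open>j < k\<close>. One factor \<open>1/2 + y + k\<close> therefore survives the
  cancellation and appears as the extra entry of \<open>shift_dens\<close>.
  The extra entry of \<open>shift_nums\<close> is the perturbation of the linear factor \<open>3k + 2\<close>.
\<close>
lemma shifted_summand:
  assumes "\<bar>y\<bar> \<le> 1/8"
  shows "summand y 0 0 k = base_term k * rational_prod (shift_nums k) (shift_dens k) y"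
proof -
  define N where "N j = 1 + 2 / (real j + 1) * y" for j
  define D where "D j = 1 + 1 / node j * y" for j
  have node: "node j \<ge> 1/2" "node j > 0" for j by (auto simp: node_def)
  have nD: "node j * D j = y + node j" for j using node(2)[of j] by (simp add: D_def field_simps)
  have D: "D j > 0" for j
  proof -
    have "y + node j > 0" using assms node(1)[of j] by linarith
    hence "0 < node j * D j" by (simp only: nD)
    thus ?thesis using node(2) by (rule zero_less_mult_pos)
  qed
  have "wz_cert y 0 0 k = wz_cert 0 0 0 k * ((\<Prod>j<k. N j) / ((\<Prod>j\<le>k. D j) * D k))"
  proof (induction k)
    case 0
    have "quad y 0 0 0 = (node 0 * D 0)\<^sup>2" unfolding nD by (simp add: quad_def node_def add.commute)
    moreover have "quad 0 0 0 0 = (node 0)\<^sup>2" by (simp add: quad_def node_def)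
    ultimately show ?case by (simp add: wz_cert_0 power2_eq_square)
  next
    case (Suc k)
    have q: "quad y 0 0 (Suc k) = (node (Suc k) * D (Suc k))\<^sup>2"
      unfolding nD by (simp add: quad_def node_def add_ac)
    have "ratio y 0 0 k = ((real k + 1) * N k) * (node k * D k) / (node (Suc k) * D (Suc k))\<^sup>2
         * (real k + 1)\<^sup>2 / (4 * node k * (real k + 1))"
    proof -
      have "(real k + 1) * N k = 2 * y + 1 + real k"
        by (simp add: N_def distrib_left)
      thus ?thesis unfolding nD[of k] ratio_def q by (simp add: node_def add_ac)
    qed
    also have "\<dots> = ratio 0 0 0 k * (N k * D k / (D (Suc k))\<^sup>2)"
    proof -
      have node_Suc: "node (Suc k) = real k + 3/2" by (simp add: node_def)
      have gen: "(n * a) * (m * d) / (m' * d')\<^sup>2 * n\<^sup>2 / (4 * m * n) = n\<^sup>2 / (4 * m'\<^sup>2) * (a * d / d'\<^sup>2)"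
        if "n > 0" "m > 0" for n a m d m' d' :: real
        using that by (simp add: power_mult_distrib mult_ac)
      have "((real k + 1) * N k) * (node k * D k) / (node (Suc k) * D (Suc k))\<^sup>2
         * (real k + 1)\<^sup>2 / (4 * node k * (real k + 1)) =
         (real k + 1)\<^sup>2 / (4 * (node (Suc k))\<^sup>2) * (N k * D k / (D (Suc k))\<^sup>2)"
        by (rule gen) (use node(2) in auto)
      thus ?thesis unfolding base_ratio node_Suc[symmetric] by (simp only:)
    qed
    finally show ?case unfolding wz_cert_Suc Suc.IH using D[of k] by (simp add: power2_eq_square mult_ac)
  qed
  moreover have "3 * real k + 2 + 2 * y = (3 * real k + 2) * (1 + 2 / (3 * real k + 2) * y)"
    by (simp add: distrib_left add_ac)
  moreover have "(\<Prod>a\<leftarrow>map g [0..<n]. 1 + a * y) = (\<Prod>j<n. 1 + g j * y)" for g :: "nat \<Rightarrow> real" and n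
    by (induction n) auto
  hence "rational_prod (shift_nums k) (shift_dens k) y =
      (\<Prod>j<k. N j) * (1 + 2 / (3 * real k + 2) * y) / ((\<Prod>j\<le>k. D j) * D k)"
    unfolding rational_prod_def shift_nums_def shift_dens_def N_def D_def lessThan_Suc_atMost[symmetric]
    by (simp only: map_append prod_list.append) simp
  ultimately show ?thesis by (simp add: summand_def base_term_def mult_ac)
qed

lemma node_ge: "node j \<ge> 1/2" "node j > 0"
  by (auto simp: node_def)

lemma node_power_le: "1 / node j ^ p \<le> 2 ^ p"
proof -
  have "(1/2) ^ p \<le> node j ^ p" using node_ge[of j] by (intro power_mono) auto
  thus ?thesis using node_ge(2)[of j] by (simp add: field_simps power_divide)
qed

lemma Suc_power_le: "1 / (real j + 1) ^ p \<le> 1"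
  by (simp add: field_simps)

lemma sum_list_map_upt: "(\<Sum>j\<leftarrow>[0..<n]. g j) = (\<Sum>j<n. g j :: real)"
  by (induction n) auto

text \<open>
  The reciprocals of the odd numbers are those of all numbers up to \<open>2k + 1\<close> minus those of the even ones.
  This converts sums over half-integers into the harmonic numbers with argument \<open>2k - 1\<close> of the theorem.
\<close>
lemma odd_reciprocal_sum:
  "(\<Sum>j<Suc k. 1 / node j ^ p) = 2 ^ p * gharm p (2 * Suc k - 1) - gharm p k"
proof (induction k)
  case 0
  show ?case by (simp add: node_def gharm_def power_divide)
next
  case (Suc k)
  have a: "gharm p (2 * Suc (Suc k) - 1) = gharm p (2 * Suc k - 1) + 1 / (2 * real (Suc k)) ^ p + 1 / (2 * node (Suc k)) ^ p"
  proof -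
    have "2 * Suc (Suc k) - 1 = Suc (Suc (2 * Suc k - 1))" by simp
    moreover have "real (Suc (2 * Suc k - 1)) = 2 * real (Suc k)"
       "real (Suc (Suc (2 * Suc k - 1))) = 2 * node (Suc k)" by (simp_all add: node_def)
    ultimately show ?thesis unfolding gharm_def by (simp only: sum.nat_ivl_Suc' sum.cl_ivl_Suc) simp
  qed
  have b: "gharm p (Suc k) = gharm p k + 1 / real (Suc k) ^ p" by (simp add: gharm_def)
  have "(\<Sum>j<Suc (Suc k). 1 / node j ^ p) = 2 ^ p * gharm p (2 * Suc k - 1) - gharm p k + 1 / node (Suc k) ^ p"
    using Suc.IH by simp
  also have "\<dots> = 2 ^ p * gharm p (2 * Suc (Suc k) - 1) - gharm p (Suc k)"
  proof -
    have gen: "2 ^ p * (1 / (2 * r) ^ p) = 1 / r ^ p" for r :: real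
      by (simp add: power_mult_distrib)
    show ?thesis unfolding a b by (simp only: distrib_left gen)
  qed
  finally show ?case .
qed

lemma reciprocal_sum: "(\<Sum>j<k. 1 / (real j + 1) ^ p) = gharm p k"
proof -
  have "gharm p k = (\<Sum>j<k. 1 / real (Suc j) ^ p)"
    unfolding gharm_def by (rule sum.reindex_bij_witness[of _ Suc "\<lambda>j. j - 1"]) auto
  thus ?thesis by (simp add: add.commute)
qed

text \<open>
  For each of the three families, the logarithmic derivative at 0 of the finite product is the combination
  of harmonic numbers that occurs in the theorem, up to rational functions of \<open>k\<close> in this first case.
\<close>
lemma sum_list_shift:
  "sum_list (shift_nums k) - sum_list (shift_dens k) =
    3 * gharm 1 k - 2 * gharm 1 (2 * Suc k - 1) + 2 / (3 * real k + 2) - 1 / node k"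
proof -
  have 1: "(\<Sum>j<k. 2 / (real j + 1)) = 2 * gharm 1 k"
    unfolding reciprocal_sum[symmetric] sum_distrib_left by simp
  have 2: "(\<Sum>j<Suc k. 1 / node j) = 2 * gharm 1 (2 * Suc k - 1) - gharm 1 k"
    using odd_reciprocal_sum[of 1 k] by (simp only: power_one_right)
  show ?thesis
    unfolding shift_nums_def shift_dens_def sum_list_append sum_list_map_upt 1 2 by simp
qed

lemma sum_list_symm_2:
  "sum_list (symm_nums (-4) 0 k) - sum_list (symm_dens (-1) 0 k) = 4 * gharm 2 (2 * Suc k - 1) - 5 * gharm 2 k"
proof -
  have 1: "(\<Sum>j<k. -4 / (real j + 1) ^ 2 + 0 / (real j + 1) ^ 3) = -4 * gharm 2 k"
    unfolding reciprocal_sum[symmetric] sum_distrib_left by simp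
  have 2: "(\<Sum>j<Suc k. -1 / node j ^ 2 + 0 / node j ^ 3) = - (4 * gharm 2 (2 * Suc k - 1) - gharm 2 k)"
    using odd_reciprocal_sum[of 2 k] by (simp add: sum_negf)
  show ?thesis
    unfolding symm_nums_def symm_dens_def sum_list_map_upt 1 2 by simp
qed

lemma sum_list_symm_3:
  "sum_list (symm_nums 0 8 k) - sum_list (symm_dens 0 (-1) k) = 8 * gharm 3 (2 * Suc k - 1) + 7 * gharm 3 k"
proof -
  have 1: "(\<Sum>j<k. 0 / (real j + 1) ^ 2 + 8 / (real j + 1) ^ 3) = 8 * gharm 3 k"
    unfolding reciprocal_sum[symmetric] sum_distrib_left by simp
  have 2: "(\<Sum>j<Suc k. 0 / node j ^ 2 + -1 / node j ^ 3) = - (8 * gharm 3 (2 * Suc k - 1) - gharm 3 k)"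
    using odd_reciprocal_sum[of 3 k] by (simp add: sum_negf)
  show ?thesis
    unfolding symm_nums_def symm_dens_def sum_list_map_upt 1 2 by simp
qed

definition shift_gf :: "real \<Rightarrow> real" where
  "shift_gf y = (\<Sum>k. base_term k * rational_prod (shift_nums k) (shift_dens k) y)"

definition symm_gf :: "real \<Rightarrow> real \<Rightarrow> real \<Rightarrow> real \<Rightarrow> real \<Rightarrow> real" where
  "symm_gf p q p' q' y = (\<Sum>k. base_term k * rational_prod (symm_nums p q k) (symm_dens p' q' k) y)"

lemma abs_shift_coeff_le: "\<forall>c \<in> set (shift_nums k) \<union> set (shift_dens k). \<bar>c\<bar> \<le> 8"
proof -
  have "2 / (real j + 1) \<le> 8" for j by (simp add: divide_le_eq)
  moreover have "2 / (3 * real j + 2) \<le> 8" for j by (simp add: divide_le_eq)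
  moreover have "1 / node j \<le> 8" for j using node_power_le[of j 1] by simp
  ultimately show ?thesis using less_imp_le[OF node_ge(2)]
    by (auto simp: shift_nums_def shift_dens_def abs_of_nonneg)
qed

lemma abs_symm_nums_le:
  assumes "c \<in> set (symm_nums p q k)"
  shows "\<bar>c\<bar> \<le> \<bar>p\<bar> + \<bar>q\<bar>"
proof -
  have "\<bar>p / (real j + 1) ^ 2 + q / (real j + 1) ^ 3\<bar> \<le> \<bar>p\<bar> + \<bar>q\<bar>" for j
  proof -
    have "\<bar>r / (real j + 1) ^ i\<bar> \<le> \<bar>r\<bar>" for r i
      using mult_left_mono[OF Suc_power_le[of j i], of "\<bar>r\<bar>"] by (simp add: abs_divide)
    thus ?thesis by (intro order_trans[OF abs_triangle_ineq] add_mono)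
  qed
  thus ?thesis using assms by (auto simp: symm_nums_def)
qed

lemma abs_symm_dens_le:
  assumes "c \<in> set (symm_dens p q k)"
  shows "\<bar>c\<bar> \<le> 4 * \<bar>p\<bar> + 8 * \<bar>q\<bar>"
proof -
  have "\<bar>p / node j ^ 2 + q / node j ^ 3\<bar> \<le> 4 * \<bar>p\<bar> + 8 * \<bar>q\<bar>" for j
  proof -
    have "\<bar>r / node j ^ i\<bar> \<le> 2 ^ i * \<bar>r\<bar>" for r i
      using mult_left_mono[OF node_power_le[of j i], of "\<bar>r\<bar>"] node_ge(2)[of j]
      by (simp add: abs_divide mult.commute)
    from add_mono[OF this[of p 2] this[of q 3]] show ?thesis
      by (intro order_trans[OF abs_triangle_ineq]) simp
  qed
  thus ?thesis using assms by (auto simp: symm_dens_def)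
qed

lemma abs_symm_2_coeff_le:
  "\<forall>c \<in> set (symm_nums (-4) 0 k) \<union> set (symm_dens (-1) 0 k). \<bar>c\<bar> \<le> 8"
  using abs_symm_nums_le[of _ "-4" 0 k] abs_symm_dens_le[of _ "-1" 0 k] by fastforce

lemma abs_symm_3_coeff_le:
  "\<forall>c \<in> set (symm_nums 0 8 k) \<union> set (symm_dens 0 (-1) k). \<bar>c\<bar> \<le> 8"
  using abs_symm_nums_le[of _ 0 8 k] abs_symm_dens_le[of _ 0 "-1" k] by fastforce

lemma length_shift: "length (shift_nums k) \<le> k + 2" "length (shift_dens k) \<le> k + 2"
  by (simp_all add: shift_nums_def shift_dens_def)

lemma length_symm: "length (symm_nums p q k) \<le> k + 2" "length (symm_dens p q k) \<le> k + 2"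
  by (simp_all add: symm_nums_def symm_dens_def)

lemmas shift_gf_derivative =
  rational_prod_series_derivative[of shift_nums shift_dens base_term, OF length_shift abs_shift_coeff_le base_term_bounds,
    folded shift_gf_def]

lemmas symm_2_gf_derivative =
  rational_prod_series_derivative[of "symm_nums (-4) 0" "symm_dens (-1) 0" base_term,
    OF length_symm abs_symm_2_coeff_le base_term_bounds, folded symm_gf_def]

lemmas symm_3_gf_derivative =
  rational_prod_series_derivative[of "symm_nums 0 8" "symm_dens 0 (-1)" base_term,
    OF length_symm abs_symm_3_coeff_le base_term_bounds, folded symm_gf_def]

text \<open>
  A function determines its value and its derivative at 0 from the right. This is how the two
  expansions of one generating function, termwise and through its evaluation, are compared.
\<close>
lemma first_order_data_unique:
  fixes G :: "real \<Rightarrow> real"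
  assumes "((\<lambda>y. (G y - a) / y) \<longlongrightarrow> d) (at_right 0)" "((\<lambda>y. (G y - b) / y) \<longlongrightarrow> e) (at_right 0)"
  shows "a = b" "d = e"
proof -
  have y: "((\<lambda>y::real. y) \<longlongrightarrow> 0) (at_right 0)" by (rule tendsto_ident_at)
  have nz: "eventually (\<lambda>y::real. y \<noteq> 0) (at_right 0)"
    using eventually_at_right_less[of "0::real"] by eventually_elim auto
  have lim: "(G \<longlongrightarrow> c) (at_right 0)" if "((\<lambda>y. (G y - c) / y) \<longlongrightarrow> l) (at_right 0)" for c l
  proof -
    have "((\<lambda>y. (G y - c) / y * y + c) \<longlongrightarrow> l * 0 + c) (at_right 0)"
      by (intro tendsto_intros that y)
    moreover have "eventually (\<lambda>y. (G y - c) / y * y + c = G y) (at_right 0)"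
      using nz by eventually_elim auto
    ultimately show ?thesis by (simp add: filterlim_cong)
  qed
  show "a = b" by (rule tendsto_unique[OF _ lim[OF assms(1)] lim[OF assms(2)]]) simp
  thus "d = e" using assms by (intro tendsto_unique[OF _ assms(1)]) auto
qed

text \<open>
  The evaluation for \<open>f = 0\<close>, divided by \<open>u = y\<close>.
\<close>
lemma shift_gf_sums:
  assumes "0 < y" "y \<le> 1/64"
  shows "(\<lambda>n. (2 * node n + y) / (node n ^ 2 * (node n + y) ^ 2)) sums shift_gf y"
proof -
  have a: "admissible y 0 0" using assms by (auto simp: admissible_def)
  have "series y 0 0 = (\<Sum>k. y * (base_term k * rational_prod (shift_nums k) (shift_dens k) y))"
    unfolding series_def using assms by (simp add: shifted_summand)
  also have "\<dots> = y * shift_gf y" unfolding shift_gf_def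
    using assms by (intro suminf_mult shift_gf_derivative(2)) auto
  finally have "(\<lambda>n. 1 / quad 0 0 0 n - 1 / quad y 0 0 n) sums (y * shift_gf y)"
    using series_0_sums[OF a] by simp
  from sums_divide[OF this, of y]
  have "(\<lambda>n. (1 / quad 0 0 0 n - 1 / quad y 0 0 n) / y) sums shift_gf y" using assms by simp
  moreover have "(1 / quad 0 0 0 n - 1 / quad y 0 0 n) / y = (2 * node n + y) / (node n ^ 2 * (node n + y) ^ 2)" for n
  proof -
    have q: "quad 0 0 0 n = node n ^ 2" "quad y 0 0 n = (node n + y) ^ 2" by (simp_all add: quad_def node_def add_ac)
    have "node n > 0" "node n + y > 0" using node_ge[of n] assms by auto
    thus ?thesis unfolding q using assms by (simp add: divide_simps) (simp add: power2_eq_square algebra_simps)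
  qed
  ultimately show ?thesis by simp
qed

text \<open>
  The evaluation for \<open>f = 0\<close> and \<open>e = -u\<close>, divided by \<open>u = sqrt y\<close>. Both sides depend only on
  \<open>y = u^2\<close>.
\<close>
lemma symm_2_gf_sums:
  assumes "0 < y" "y \<le> 1/64"
  shows "(\<lambda>n. 2 / (node n * (node n ^ 2 - y))) sums symm_gf (-4) 0 (-1) 0 y"
proof -
  define x where "x = sqrt y"
  have x: "x > 0" "x\<^sup>2 = y" "x \<le> 1/8"
  proof -
    have "sqrt y \<le> sqrt ((1/8)\<^sup>2)"
      using assms by (intro real_sqrt_le_mono) (simp add: power2_eq_square)
    thus "x \<le> 1/8" by (simp add: x_def)
  qed (use assms in \<open>auto simp: x_def\<close>)
  have a: "admissible x (-x) 0" using x by (auto simp: admissible_def)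
  have "summand x (-x) 0 k = base_term k * rational_prod (symm_nums (-4) 0 k) (symm_dens (-1) 0 k) y" for k
    using x by (intro antisymmetric_summand) (simp_all add: algebra_simps)
  hence "series x (-x) 0 = (\<Sum>k. x * (base_term k * rational_prod (symm_nums (-4) 0 k) (symm_dens (-1) 0 k) y))"
    unfolding series_def by simp
  also have "\<dots> = x * symm_gf (-4) 0 (-1) 0 y" unfolding symm_gf_def
    using assms by (intro suminf_mult symm_2_gf_derivative(2)) auto
  finally have "(\<lambda>n. 1 / quad 0 (-x) 0 n - 1 / quad x (-x) 0 n) sums (x * symm_gf (-4) 0 (-1) 0 y)"
    using series_0_sums[OF a] by simp
  from sums_divide[OF this, of x]
  have "(\<lambda>n. (1 / quad 0 (-x) 0 n - 1 / quad x (-x) 0 n) / x) sums symm_gf (-4) 0 (-1) 0 y" using x by simp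
  moreover have "(1 / quad 0 (-x) 0 n - 1 / quad x (-x) 0 n) / x = 2 / (node n * (node n ^ 2 - y))" for n
  proof -
    have q: "quad 0 (-x) 0 n = node n * (node n - x)" "quad x (-x) 0 n = node n * (node n + x)"
      by (simp_all add: quad_def node_def power2_eq_square algebra_simps)
    have "node n > 0" "node n + x > 0" "node n - x > 0" using node_ge[of n] x by auto
    moreover have "node n ^ 2 - y = (node n - x) * (node n + x)" using x(2) by (simp add: power2_eq_square algebra_simps)
    moreover have "(1 / (m * s) - 1 / (m * t)) / x = 2 / (m * (s * t))"
      if "m > 0" "s > 0" "t > 0" "t - s = 2 * x" for m s t
    proof -
      have "1 / (m * s) - 1 / (m * t) = (t - s) / (m * (s * t))" using that(1-3) by (simp add: diff_divide_distrib)
      thus ?thesis using x(1) that(4) by simp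
    qed
    ultimately show ?thesis unfolding q by simp
  qed
  ultimately show ?thesis by simp
qed

text \<open>
  Tannery's theorem with the summable majorant \<open>M / m^2\<close>, which serves for both evaluated sums.
\<close>
lemma tendsto_suminf_node:
  assumes lim: "\<And>n. ((\<lambda>y. h n y) \<longlongrightarrow> l n) (at_right (0::real))"
    and dom: "\<And>n y. 0 < y \<Longrightarrow> y \<le> 1/64 \<Longrightarrow> \<bar>h n y :: real\<bar> \<le> M / node n ^ 2"
  shows "((\<lambda>y. \<Sum>n. h n y) \<longlongrightarrow> suminf l) (at_right 0)"
proof -
  have M: "summable (\<lambda>n. M / node n ^ 2)"
    using half_integer_power_sums[of 2] sums_mult[of _ _ M] by (fastforce simp: node_def dest: sums_summable)
  have "eventually (\<lambda>(n, y). norm (h n y) \<le> M / node n ^ 2) (at_top \<times>\<^sub>F at_right 0)"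
    unfolding eventually_prod_filter
  proof (rule exI[of _ "\<lambda>_::nat. True"], rule exI[of _ "\<lambda>y. 0 < y \<and> y \<le> 1/64"], intro conjI allI impI)
    show "eventually (\<lambda>y. 0 < y \<and> y \<le> 1/64) (at_right (0::real))"
      by (auto simp: eventually_at dist_real_def intro!: exI[of _ "1/64"])
  qed (use dom in auto)
  from tannerys_theorem[OF lim this M] show ?thesis by simp
qed

lemma at_0_imp_at_right_0: "(f \<longlongrightarrow> l) (at (0::real)) \<Longrightarrow> (f \<longlongrightarrow> l) (at_right 0)"
  by (rule filterlim_mono[OF _ order_refl at_le]) auto

lemma node_sums_3: "(\<lambda>n. 2 / node n ^ 3) sums (14 * zeta 3)"
  using sums_mult[OF half_integer_power_sums[of 3], of 2] by (simp add: node_def)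

lemma gf_at_0: "shift_gf 0 = suminf base_term" "symm_gf p q p' q' 0 = suminf base_term"
  by (simp_all add: shift_gf_def symm_gf_def rational_prod_def prod_list_map_1)

section \<open>The derivatives at the origin\<close>

lemma shift_gf_difference_quotient:
  "((\<lambda>y. (shift_gf y - 14 * zeta 3) / y) \<longlongrightarrow> - (pi ^ 4 / 2)) (at_right 0)"
proof -
  define h where "h n y = - (3 * node n + 2 * y) / (node n ^ 3 * (node n + y) ^ 2)" for n y
  have eq: "(shift_gf y - 14 * zeta 3) / y = (\<Sum>n. h n y)" if y: "0 < y" "y \<le> 1/64" for y
  proof -
    \<comment> \<open>Subtracting the value \<open>2 / m^3\<close> at \<open>y = 0\<close> termwise leaves a factor \<open>y\<close> in the numerator.\<close>
    have "(\<lambda>n. ((2 * node n + y) / (node n ^ 2 * (node n + y) ^ 2) - 2 / node n ^ 3) / y)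
        sums ((shift_gf y - 14 * zeta 3) / y)"
      by (intro sums_divide sums_diff shift_gf_sums node_sums_3 y)
    moreover have "((2 * m + y) / (m ^ 2 * (m + y) ^ 2) - 2 / m ^ 3) / y =
        - (3 * m + 2 * y) / (m ^ 3 * (m + y) ^ 2)" if m: "m > 0" for m
    proof -
      have "(2 * m + y) / (m ^ 2 * (m + y) ^ 2) = (m * (2 * m + y)) / (m ^ 3 * (m + y) ^ 2)"
        using m by (simp add: power2_eq_square power3_eq_cube)
      moreover have "2 / m ^ 3 = (2 * (m + y) ^ 2) / (m ^ 3 * (m + y) ^ 2)"
        using m y by simp
      ultimately have "(2 * m + y) / (m ^ 2 * (m + y) ^ 2) - 2 / m ^ 3 =
          (m * (2 * m + y) - 2 * (m + y) ^ 2) / (m ^ 3 * (m + y) ^ 2)"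
        by (simp only: diff_divide_distrib)
      also have "m * (2 * m + y) - 2 * (m + y) ^ 2 = - (3 * m + 2 * y) * y"
        by (simp add: power2_eq_square algebra_simps)
      finally show ?thesis using y by simp
    qed
    ultimately show ?thesis using node_ge(2) by (simp add: h_def sums_iff)
  qed
  have "((\<lambda>y. \<Sum>n. h n y) \<longlongrightarrow> (\<Sum>n. -3 * (1 / node n ^ 4))) (at_right 0)"
  proof (rule tendsto_suminf_node[where M = 28])
    fix n
    have "((\<lambda>y. h n y) \<longlongrightarrow> - (3 * node n + 2 * 0) / (node n ^ 3 * (node n + 0) ^ 2)) (at_right 0)"
      unfolding h_def using node_ge(2)[of n] by (intro tendsto_intros) auto
    thus "((\<lambda>y. h n y) \<longlongrightarrow> -3 * (1 / node n ^ 4)) (at_right 0)"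
      using node_ge(2)[of n] by (simp add: power2_eq_square power3_eq_cube power4_eq_xxxx mult_ac)
  next
    fix n and y :: real assume y: "0 < y" "y \<le> 1/64"
    define m where "m = node n"
    have m: "m \<ge> 1/2" using node_ge by (simp add: m_def)
    have "\<bar>h n y\<bar> = (3 * m + 2 * y) / (m ^ 3 * (m + y) ^ 2)"
      using m y by (simp add: h_def m_def[symmetric] abs_divide abs_mult)
    also have "\<dots> \<le> (7 * m) / (m ^ 3 * m ^ 2)"
      using m y by (intro frac_le mult_left_mono power_mono) auto
    also have "\<dots> = 7 * (1 / m ^ 2) * (1 / m ^ 2)"
      using m by (simp add: power2_eq_square power3_eq_cube)
    also have "\<dots> \<le> 7 * (1 / m ^ 2) * 2 ^ 2"
      using node_power_le[of n 2] by (intro mult_left_mono) (auto simp: m_def)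
    finally show "\<bar>h n y\<bar> \<le> 28 / node n ^ 2" by (simp add: m_def)
  qed
  also have "(\<Sum>n. -3 * (1 / node n ^ 4)) = - (pi ^ 4 / 2)"
    using sums_mult[OF half_integer_fourth_power_sums, of "-3"] by (simp add: node_def sums_iff)
  finally show ?thesis
  proof (rule Lim_transform_eventually)
    show "eventually (\<lambda>y. (\<Sum>n. h n y) = (shift_gf y - 14 * zeta 3) / y) (at_right 0)"
      by (auto simp: eventually_at dist_real_def eq intro!: exI[of _ "1/64"])
  qed
qed

lemma symm_2_gf_difference_quotient:
  "((\<lambda>y. (symm_gf (-4) 0 (-1) 0 y - 14 * zeta 3) / y) \<longlongrightarrow> 62 * zeta 5) (at_right 0)"
proof -
  define h where "h n y = 2 / (node n ^ 3 * (node n ^ 2 - y))" for n y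
  have my: "node n ^ 2 - y \<ge> 1/8" if "y \<le> 1/64" for n y
  proof -
    have "(1/2)^2 \<le> node n ^ 2" using node_ge[of n] by (intro power_mono) auto
    thus ?thesis using that by (simp add: power2_eq_square)
  qed
  have eq: "(symm_gf (-4) 0 (-1) 0 y - 14 * zeta 3) / y = (\<Sum>n. h n y)" if y: "0 < y" "y \<le> 1/64" for y
  proof -
    have "(\<lambda>n. (2 / (node n * (node n ^ 2 - y)) - 2 / node n ^ 3) / y)
        sums ((symm_gf (-4) 0 (-1) 0 y - 14 * zeta 3) / y)"
      by (intro sums_divide sums_diff symm_2_gf_sums node_sums_3 y)
    moreover have "(2 / (node n * (node n ^ 2 - y)) - 2 / node n ^ 3) / y = h n y" for n
    proof -
      have g: "(2 / (m * d) - 2 / m ^ 3) / y = 2 / (m ^ 3 * d)" if "m > 0" "d > 0" "m ^ 2 - d = y" for m d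
      proof -
        have "2 / (m * d) - 2 / m ^ 3 = (2 * m ^ 2 - 2 * d) / (m ^ 3 * d)"
          using that by (simp add: diff_divide_distrib power2_eq_square power3_eq_cube)
        also have "2 * m ^ 2 - 2 * d = 2 * y" using that(3) by simp
        finally show ?thesis using y by simp
      qed
      show ?thesis unfolding h_def using my[of y n] node_ge(2)[of n] y by (intro g) auto
    qed
    ultimately show ?thesis by (simp add: sums_iff)
  qed
  have "((\<lambda>y. \<Sum>n. h n y) \<longlongrightarrow> (\<Sum>n. 2 * (1 / node n ^ 5))) (at_right 0)"
  proof (rule tendsto_suminf_node[where M = 32])
    fix n
    have "((\<lambda>y. h n y) \<longlongrightarrow> 2 / (node n ^ 3 * (node n ^ 2 - 0))) (at_right 0)"
      unfolding h_def using node_ge(2)[of n] by (intro tendsto_intros) auto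
    thus "((\<lambda>y. h n y) \<longlongrightarrow> 2 * (1 / node n ^ 5)) (at_right 0)"
      by (simp add: power_add[symmetric])
  next
    fix n and y :: real assume y: "0 < y" "y \<le> 1/64"
    have "\<bar>h n y\<bar> = 2 / (node n ^ 3 * (node n ^ 2 - y))"
      using my[OF y(2), of n] node_ge(2)[of n] by (simp add: h_def abs_divide abs_mult)
    also have "\<dots> \<le> 2 / (node n ^ 3 * (1/8))"
      using my[OF y(2), of n] node_ge(2)[of n] by (intro divide_left_mono mult_left_mono mult_pos_pos) auto
    also have "\<dots> = 16 * (1 / node n ^ 2) * (1 / node n ^ 1)"
      by (simp add: power2_eq_square power3_eq_cube)
    also have "\<dots> \<le> 16 * (1 / node n ^ 2) * 2 ^ 1"
      using node_power_le[of n 1] by (intro mult_left_mono) auto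
    finally show "\<bar>h n y\<bar> \<le> 32 / node n ^ 2" by simp
  qed
  also have "(\<Sum>n. 2 * (1 / node n ^ 5)) = 62 * zeta 5"
    using sums_mult[OF half_integer_power_sums[of 5], of 2] by (simp add: node_def sums_iff)
  finally show ?thesis
  proof (rule Lim_transform_eventually)
    show "eventually (\<lambda>y. (\<Sum>n. h n y) = (symm_gf (-4) 0 (-1) 0 y - 14 * zeta 3) / y) (at_right 0)"
      by (auto simp: eventually_at dist_real_def eq intro!: exI[of _ "1/64"])
  qed
qed

lemma base_sum_and_shift_derivative:
  "suminf base_term = 14 * zeta 3"
  "(\<lambda>k. base_term k * (sum_list (shift_nums k) - sum_list (shift_dens k))) sums - (pi ^ 4 / 2)"
proof -
  note d = at_0_imp_at_right_0[OF shift_gf_derivative(3)] and u = shift_gf_difference_quotient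
  show "suminf base_term = 14 * zeta 3" using first_order_data_unique(1)[OF d u] by (simp add: gf_at_0)
  show "(\<lambda>k. base_term k * (sum_list (shift_nums k) - sum_list (shift_dens k))) sums - (pi ^ 4 / 2)"
    using summable_sums[OF shift_gf_derivative(1)] first_order_data_unique(2)[OF d u] by simp
qed

lemma symm_2_derivative_sums:
  "(\<lambda>k. base_term k * (sum_list (symm_nums (-4) 0 k) - sum_list (symm_dens (-1) 0 k))) sums (62 * zeta 5)"
  using summable_sums[OF symm_2_gf_derivative(1)]
    first_order_data_unique(2)[OF at_0_imp_at_right_0[OF symm_2_gf_derivative(3)] symm_2_gf_difference_quotient]
  by simp

lemma cubic_family_eq:
  assumes "\<bar>x\<bar> \<le> 1/8"
  shows "cubic_family x = 1 + x ^ 3 * symm_gf 0 8 0 (-1) (x ^ 3)"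
proof -
  have x3: "\<bar>x ^ 3\<bar> \<le> 1/64"
  proof -
    have "\<bar>x\<bar> ^ 3 \<le> (1/8) ^ 3" using assms by (intro power_mono) auto
    moreover have "\<bar>x ^ 3\<bar> = \<bar>x\<bar> ^ 3" by (rule power_abs)
    ultimately show ?thesis by (simp add: power_divide)
  qed
  have "summand x (-x) (x\<^sup>2) k = base_term k * rational_prod (symm_nums 0 8 k) (symm_dens 0 (-1) k) (x ^ 3)" for k
    by (intro antisymmetric_summand) (simp_all add: power2_eq_square power3_eq_cube)
  hence "series x (-x) (x\<^sup>2) = (\<Sum>k. x * (base_term k * rational_prod (symm_nums 0 8 k) (symm_dens 0 (-1) k) (x ^ 3)))"
    unfolding series_def by simp
  also have "\<dots> = x * symm_gf 0 8 0 (-1) (x ^ 3)"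
    unfolding symm_gf_def by (rule suminf_mult[OF symm_3_gf_derivative(2)[OF x3]])
  finally show ?thesis by (simp add: cubic_family_def power2_eq_square power3_eq_cube)
qed

text \<open>
  Every \<open>y\<close> is the cube of a real \<open>x\<close>, and \<open>|y| \<le> 1/512\<close> corresponds to \<open>|x| \<le> 1/8\<close>, so the reflection of
  the cubic family is a functional equation in \<open>y\<close>.
\<close>
lemma symm_3_gf_reflection:
  assumes "\<bar>y\<bar> \<le> 1/512"
  defines "H \<equiv> symm_gf 0 8 0 (-1)"
  shows "(1 + y * H y) * (1 - y * H (- y)) = 1"
proof -
  define x where "x = root 3 y"
  have y: "y = x ^ 3" by (simp add: x_def odd_real_root_pow)
  have "\<bar>x\<bar> = root 3 \<bar>y\<bar>" by (simp add: x_def real_root_abs)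
  also have "\<dots> \<le> root 3 ((1/8) ^ 3)"
    using assms(1) by (intro real_root_le_mono) (auto simp: power3_eq_cube)
  also have "\<dots> = 1/8" by (rule real_root_power_cancel) auto
  finally have x: "\<bar>x\<bar> \<le> 1/8" .
  have "cubic_family x * cubic_family (- x) = 1" by (rule cubic_family_reflection[OF x])
  thus ?thesis using cubic_family_eq[OF x] cubic_family_eq[of "-x"] x by (simp add: y H_def)
qed

text \<open>
  Divided by \<open>y^2\<close>, the functional equation reads \<open>(H(y) - H(-y)) / y = H(y) H(-y)\<close>. As \<open>y\<close> tends to 0, the
  left-hand side tends to \<open>2 H'(0)\<close> and the right-hand side to \<open>H(0)^2\<close>.
\<close>
lemma symm_3_derivative_sums:
  "(\<lambda>k. base_term k * (sum_list (symm_nums 0 8 k) - sum_list (symm_dens 0 (-1) k))) sums (98 * zeta 3 ^ 2)"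
proof -
  define H where "H = symm_gf 0 8 0 (-1)"
  define d where "d = (\<Sum>k. base_term k * (sum_list (symm_nums 0 8 k) - sum_list (symm_dens 0 (-1) k)))"
  have H0: "H 0 = 14 * zeta 3" by (simp add: H_def gf_at_0 base_sum_and_shift_derivative)
  have d: "((\<lambda>y. (H y - H 0) / y) \<longlongrightarrow> d) (at 0)"
    unfolding H_def d_def by (rule symm_3_gf_derivative(3))
  have neg: "filterlim uminus (at 0) (at (0::real))"
    by (auto simp: filterlim_at eventually_at_filter intro!: tendsto_eq_intros)
  have d': "((\<lambda>y. (H (- y) - H 0) / (- y)) \<longlongrightarrow> d) (at 0)"
    by (rule filterlim_compose[OF d neg])
  have H: "(H \<longlongrightarrow> H 0) (at 0)"
  proof -
    have "(H has_real_derivative d) (at 0)" using d by (simp add: has_field_derivative_iff)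
    from DERIV_isCont[OF this] show ?thesis by (simp add: isCont_def)
  qed
  have H': "((\<lambda>y. H (- y)) \<longlongrightarrow> H 0) (at 0)" by (rule filterlim_compose[OF H neg])
  have "((\<lambda>y. H y * H (- y)) \<longlongrightarrow> d + d) (at 0)"
  proof (rule Lim_transform_eventually[OF tendsto_add[OF d d']])
    have "(H y - H 0) / y + (H (- y) - H 0) / (- y) = H y * H (- y)" if y: "y \<noteq> 0" "\<bar>y\<bar> \<le> 1/512" for y
    proof -
      have "(1 + y * H y) * (1 - y * H (- y)) = 1"
        unfolding H_def by (rule symm_3_gf_reflection[OF y(2)])
      hence "y * (H y - H (- y)) = y * (y * (H y * H (- y)))" by (simp add: algebra_simps)
      hence "H y - H (- y) = y * (H y * H (- y))" using y(1) by simp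
      thus ?thesis using y(1) by (simp add: field_simps)
    qed
    thus "eventually (\<lambda>y. (H y - H 0) / y + (H (- y) - H 0) / (- y) = H y * H (- y)) (at 0)"
      by (auto simp: eventually_at dist_real_def intro!: exI[of _ "1/512"])
  qed
  moreover have "((\<lambda>y. H y * H (- y)) \<longlongrightarrow> H 0 * H 0) (at 0)" by (rule tendsto_mult[OF H H'])
  ultimately have "d + d = H 0 * H 0" by (rule tendsto_unique[OF at_neq_bot])
  hence "d = 98 * zeta 3 ^ 2" by (simp add: H0 power2_eq_square)
  thus ?thesis using summable_sums[OF symm_3_gf_derivative(1)] by (simp add: d_def)
qed

text \<open>
  In the first series \<open>A = 3k - 1\<close> and \<open>B = 2k - 1\<close>: the summand \<open>2k / (2k - 1)\<close> there is the combined
  effect of \<open>2 / A\<close>, from the linear factor, and \<open>2 / B\<close>, from the last denominator.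
\<close>
lemma shift_term_identity:
  fixes A B K W b h H :: real
  assumes "A * W = b / 8" "A \<noteq> 0" "B \<noteq> 0" "2 * K = 2 * A - 2 * B"
  shows "W * (A * (2 * H - 3 * h) + 2 * K / B) = - 1 / 8 * (b * (3 * h - 2 * H + 2 / A - 2 / B))"
proof -
  have b: "b = 8 * (A * W)" using assms(1) by simp
  have "A * (2 / A - 2 / B) = - (2 * K / B)"
    using assms(2,3) by (simp add: assms(4) right_diff_distrib diff_divide_distrib)
  hence "A * (2 * H - 3 * h) + 2 * K / B = - (A * (3 * h - 2 * H + 2 / A - 2 / B))"
    by (simp add: algebra_simps)
  thus ?thesis by (simp add: b)
qed

theorem theorem1p13:
  shows "((\<lambda>i. let k = Suc i in
            4 ^ k / ((2 * real k - 1) * real k ^ 3 * real ((2 * k) choose k) ^ 2)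
              * ((3 * real k - 1) * (2 * gharm 1 (2 * k - 1) - 3 * gharm 1 (k - 1))
                 + 2 * real k / (2 * real k - 1)))
         sums (pi ^ 4 / 16)) \<and>
         ((\<lambda>i. let k = Suc i in
            (3 * real k - 1) * 4 ^ k / ((2 * real k - 1) * real k ^ 3 * real ((2 * k) choose k) ^ 2)
              * (4 * gharm 2 (2 * k - 1) - 5 * gharm 2 (k - 1)))
         sums (31 / 4 * zeta 5)) \<and>
         ((\<lambda>i. let k = Suc i in
            (3 * real k - 1) * 4 ^ k / ((2 * real k - 1) * real k ^ 3 * real ((2 * k) choose k) ^ 2)
              * (8 * gharm 3 (2 * k - 1) + 7 * gharm 3 (k - 1)))
         sums (49 / 4 * (zeta 3) ^ 2))"
  unfolding Let_def base_term_central_binomial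
proof (intro conjI)
  show "(\<lambda>i. 4 ^ Suc i / ((2 * real (Suc i) - 1) * real (Suc i) ^ 3 * real ((2 * Suc i) choose Suc i) ^ 2)
              * ((3 * real (Suc i) - 1) * (2 * gharm 1 (2 * Suc i - 1) - 3 * gharm 1 (Suc i - 1))
                 + 2 * real (Suc i) / (2 * real (Suc i) - 1))) sums (pi ^ 4 / 16)"
  proof -
    have "4 ^ Suc i / ((2 * real (Suc i) - 1) * real (Suc i) ^ 3 * real ((2 * Suc i) choose Suc i) ^ 2)
              * ((3 * real (Suc i) - 1) * (2 * gharm 1 (2 * Suc i - 1) - 3 * gharm 1 (Suc i - 1))
                 + 2 * real (Suc i) / (2 * real (Suc i) - 1)) =
         -1 / 8 * (base_term i * (sum_list (shift_nums i) - sum_list (shift_dens i)))" for i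
    proof -
      have 1: "3 * real i + 2 = 3 * real (Suc i) - 1" by simp
      have 2: "1 / node i = 2 / (2 * real (Suc i) - 1)" by (simp add: node_def field_simps)
      have 3: "Suc i - 1 = i" by simp
      show ?thesis unfolding sum_list_shift 1 2 3
      proof (rule shift_term_identity)
        show "(3 * real (Suc i) - 1) * (4 ^ Suc i / ((2 * real (Suc i) - 1) * real (Suc i) ^ 3 *
            (real ((2 * Suc i) choose Suc i))\<^sup>2)) = base_term i / 8"
          unfolding times_divide_eq_right by (rule base_term_central_binomial)
      qed simp_all
    qed
    moreover have "- 1 / 8 * - (pi ^ 4 / 2) = pi ^ 4 / 16" by simp
    ultimately show ?thesis
      using sums_mult[OF base_sum_and_shift_derivative(2), of "- 1 / 8"] by (simp only:)
  qed
  have eighth: "b / 8 * X = 1 / 8 * (b * X)" for b X :: real by simp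
  have "base_term i / 8 * (4 * gharm 2 (2 * Suc i - 1) - 5 * gharm 2 (Suc i - 1)) =
      1 / 8 * (base_term i * (sum_list (symm_nums (-4) 0 i) - sum_list (symm_dens (-1) 0 i)))" for i
    unfolding sum_list_symm_2 diff_Suc_1 by (rule eighth)
  moreover have "1 / 8 * (62 * zeta 5) = 31 / 4 * zeta 5" by simp
  ultimately show "(\<lambda>i. base_term i / 8 * (4 * gharm 2 (2 * Suc i - 1) - 5 * gharm 2 (Suc i - 1))) sums (31 / 4 * zeta 5)"
    using sums_mult[OF symm_2_derivative_sums, of "1 / 8"] by (simp only:)
  have "base_term i / 8 * (8 * gharm 3 (2 * Suc i - 1) + 7 * gharm 3 (Suc i - 1)) =
      1 / 8 * (base_term i * (sum_list (symm_nums 0 8 i) - sum_list (symm_dens 0 (-1) i)))" for i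
    unfolding sum_list_symm_3 diff_Suc_1 by (rule eighth)
  moreover have "1 / 8 * (98 * (zeta 3)\<^sup>2) = 49 / 4 * (zeta 3)\<^sup>2" by simp
  ultimately show "(\<lambda>i. base_term i / 8 * (8 * gharm 3 (2 * Suc i - 1) + 7 * gharm 3 (Suc i - 1))) sums (49 / 4 * (zeta 3)\<^sup>2)"
    using sums_mult[OF symm_3_derivative_sums, of "1 / 8"] by (simp only:)
qed

end
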